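(* On $\mathcal{D}(X)\cap\mathcal{D}(D)$ one has $$(\mathcal{B}^S_{\mathbb{H}})^{-1}M_q\,\mathcal{B}^S_{\mathbb{H}}=\frac{1}{\sqrt2}(X-D),$$ where $M_q:\varphi\mapsto M_q\varphi(q)=q\varphi(q)$ denotes the creation operator on $\mathcal{F}^{2,1}_{Slice}(\mathbb{H})$.
   Context: $\mathbb{H}$ is the algebra of real quaternions, $\mathbb{S}=\{q\in\mathbb{H}:q^2=-1\}$, $\mathbb{C}_I=\mathbb{R}+\mathbb{R}I$ for $I\in\mathbb{S}$. $L^2(\mathbb{R},\mathbb{H})$ is the space of square integrable $\mathbb{H}$-valued functions on $\mathbb{R}$. The position and momentum operators are $X\varphi(x)=x\varphi(x)$ and $D\varphi(x)=\frac{d}{dx}\varphi(x)$ (derivative in the weak sense), with domains $\mathcal{D}(X)=\{\varphi\in L^2(\mathbb{R},\mathbb{H}):X\varphi\in L^2(\mathbb{R},\mathbb{H})\}$ and $\mathcal{D}(D)=\{\varphi\in L^2(\mathbb{R},\mathbb{H}):D\varphi\in L^2(\mathbb{R},\mathbb{H})\}$. A function $f:\mathbb{H}\to\mathbb{H}$ is (left) slice regular if, for each $I\in\mathbb{S}$, its restriction $f_I$ to $\mathbb{C}_I$ has continuous partial derivatives and satisfies $\frac12\left(\frac{\partial}{\partial x}+I\frac{\partial}{\partial y}\right)f_I(x+Iy)=0$. $\mathcal{F}^{2,1}_{Slice}(\mathbb{H})$ is the space of slice regular $f:\mathbb{H}\to\mathbb{H}$ with $\int_{\mathbb{C}_I}|f_I(p)|^2e^{-|p|^2}d\lambda_I(p)<\infty$,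 where $d\lambda_I(p)=dx\,dy$ for $p=x+yI$; it is independent of the choice of $I\in\mathbb{S}$. The quaternionic Segal-Bargmann transform (with parameter $\nu=1$) is $$\mathcal{B}^S_{\mathbb{H}}(\varphi)(q)=\int_{\mathbb{R}}\mathcal{A}^S_{\mathbb{H}}(q,x)\varphi(x)\,dx,\qquad \mathcal{A}^S_{\mathbb{H}}(q,x)=\pi^{-3/4}e^{-\frac12(q^2+x^2)+\sqrt2\,qx};$$ it is a known fact that it is an isometric bijection from $L^2(\mathbb{R},\mathbb{H})$ onto $\mathcal{F}^{2,1}_{Slice}(\mathbb{H})$. *)

theory Defs
  imports "HOL-Analysis.Analysis"
begin

section \<open>Quaternions\<close>

datatype quat = Quat (qRe: real) (qI: real) (qJ: real) (qK: real)

lemma quat_eq_iff: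
  "p = q \<longleftrightarrow> qRe p = qRe q \<and> qI p = qI q \<and> qJ p = qJ q \<and> qK p = qK q"
  by (cases p; cases q) simp

instantiation quat :: ring_1
begin

definition "0 = Quat 0 0 0 0"
definition "1 = Quat 1 0 0 0"
definition "p + q = Quat (qRe p + qRe q) (qI p + qI q) (qJ p + qJ q) (qK p + qK q)"
definition "p - q = Quat (qRe p - qRe q) (qI p - qI q) (qJ p - qJ q) (qK p - qK q)"
definition "- q = Quat (- qRe q) (- qI q) (- qJ q) (- qK q)"
definition "p * q = Quat
   (qRe p * qRe q - qI p * qI q - qJ p * qJ q - qK p * qK q)
   (qRe p * qI q + qI p * qRe q + qJ p * qK q - qK p * qJ q)
   (qRe p * qJ q - qI p * qK q + qJ p * qRe q + qK p * qI q)
   (qRe p * qK q + qI p * qJ q - qJ p * qI q + qK p * qRe q)"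

instance
  by standard
    (simp_all add: quat_eq_iff zero_quat_def one_quat_def plus_quat_def minus_quat_def
      uminus_quat_def times_quat_def algebra_simps)

end

lemmas quat_arith_defs = zero_quat_def one_quat_def plus_quat_def minus_quat_def
  uminus_quat_def times_quat_def

instantiation quat :: real_algebra_1
begin

definition "r *\<^sub>R q = Quat (r * qRe q) (r * qI q) (r * qJ q) (r * qK q)"

instance
  by standard (simp_all add: quat_eq_iff quat_arith_defs scaleR_quat_def algebra_simps)

end

instantiation quat :: real_div_algebra
begin

definition "inverse q =
  (let n = (qRe q)\<^sup>2 + (qI q)\<^sup>2 + (qJ q)\<^sup>2 + (qK q)\<^sup>2
   in Quat (qRe q / n) (- qI q / n) (- qJ q / n) (- qK q / n))"
definition "(p :: quat) div q = p * inverse q"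

instance
proof
  fix q :: quat
  define n where "n = (qRe q)\<^sup>2 + (qI q)\<^sup>2 + (qJ q)\<^sup>2 + (qK q)\<^sup>2"
  assume "q \<noteq> 0"
  then have "qRe q \<noteq> 0 \<or> qI q \<noteq> 0 \<or> qJ q \<noteq> 0 \<or> qK q \<noteq> 0"
    by (auto simp: quat_eq_iff zero_quat_def)
  then have "(qRe q)\<^sup>2 > 0 \<or> (qI q)\<^sup>2 > 0 \<or> (qJ q)\<^sup>2 > 0 \<or> (qK q)\<^sup>2 > 0"
    by auto
  moreover have "(qRe q)\<^sup>2 \<ge> 0" "(qI q)\<^sup>2 \<ge> 0" "(qJ q)\<^sup>2 \<ge> 0" "(qK q)\<^sup>2 \<ge> 0"
    by auto
  ultimately have n: "n \<noteq> 0"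
    unfolding n_def by linarith
  have inv: "inverse q = Quat (qRe q / n) (- qI q / n) (- qJ q / n) (- qK q / n)"
    by (simp add: inverse_quat_def n_def Let_def)
  have nn: "n = qRe q * qRe q + qI q * qI q + qJ q * qJ q + qK q * qK q"
    by (simp add: n_def power2_eq_square)
  show "inverse q * q = 1" "q * inverse q = 1"
    using n unfolding inv quat_eq_iff one_quat_def times_quat_def quat.sel
    by (simp_all add: divide_simps) (simp_all add: nn mult.commute)
next
  show "inverse (0 :: quat) = 0"
    by (simp add: inverse_quat_def zero_quat_def)
qed (rule divide_quat_def)

end

instantiation quat :: real_inner
begin

definition "inner p q = qRe p * qRe q + qI p * qI q + qJ p * qJ q + qK p * qK q"
definition "norm (q :: quat) = sqrt (inner q q)"
definition "sgn (q :: quat) = q /\<^sub>R norm q"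
definition "dist p (q :: quat) = norm (p - q)"
definition uniformity_quat_def [code del]:
  "(uniformity :: (quat \<times> quat) filter) = (INF e\<in>{0 <..}. principal {(p, q). dist p q < e})"
definition open_quat_def [code del]:
  "open (U :: quat set) \<longleftrightarrow> (\<forall>p\<in>U. eventually (\<lambda>(p', q). p' = p \<longrightarrow> q \<in> U) uniformity)"

instance
proof
  fix p q r :: quat and c :: real
  show "inner p q = inner q p"
    by (simp add: inner_quat_def mult.commute)
  show "inner (p + q) r = inner p r + inner q r"
    by (simp add: inner_quat_def plus_quat_def algebra_simps)
  show "inner (c *\<^sub>R p) q = c * inner p q"
    by (simp add: inner_quat_def scaleR_quat_def algebra_simps)
  show "0 \<le> inner p p"
    by (simp add: inner_quat_def)
  show "inner p p = 0 \<longleftrightarrow> p = 0"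
    by (auto simp: inner_quat_def quat_eq_iff zero_quat_def add_nonneg_eq_0_iff)
qed (rule norm_quat_def sgn_quat_def dist_quat_def uniformity_quat_def open_quat_def)+

end

instance quat :: real_normed_div_algebra
proof
  fix p q :: quat
  show "norm (p * q) = norm p * norm q"
    unfolding norm_quat_def real_sqrt_mult [symmetric] inner_quat_def times_quat_def quat.sel
    by (rule arg_cong [where f = sqrt]) algebra
qed

instantiation quat :: euclidean_space
begin

definition "Basis = {Quat 1 0 0 0, Quat 0 1 0 0, Quat 0 0 1 0, Quat 0 0 0 1}"

instance
proof
  show "(Basis :: quat set) \<noteq> {}" "finite (Basis :: quat set)"
    by (simp_all add: Basis_quat_def)
  show "inner u v = (if u = v then 1 else 0)" if "u \<in> Basis" "v \<in> Basis" for u v :: quat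
    using that unfolding Basis_quat_def by (elim insertE emptyE) (simp_all add: inner_quat_def)
  show "(\<forall>u\<in>Basis. inner q u = 0) \<longleftrightarrow> q = 0" for q :: quat
    by (cases q) (simp add: Basis_quat_def inner_quat_def zero_quat_def)
qed

end


section \<open>The slice hyperholomorphic Fock space\<close>

definition imag_sphere :: "quat set" where
  "imag_sphere = {q. q\<^sup>2 = -1}"

definition slice_pt :: "quat \<Rightarrow> real \<Rightarrow> real \<Rightarrow> quat" where
  "slice_pt I x y = of_real x + of_real y * I"

definition slice_regular :: "(quat \<Rightarrow> quat) \<Rightarrow> bool" where
  "slice_regular f \<longleftrightarrow> (\<forall>I\<in>imag_sphere. \<exists>fx fy.
     continuous_on UNIV (\<lambda>(x, y). fx x y) \<and> continuous_on UNIV (\<lambda>(x, y). fy x y) \<and>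
     (\<forall>x y. ((\<lambda>t. f (slice_pt I t y)) has_vector_derivative fx x y) (at x) \<and>
            ((\<lambda>t. f (slice_pt I x t)) has_vector_derivative fy x y) (at y) \<and>
            (1/2) *\<^sub>R (fx x y + I * fy x y) = 0))"

text \<open>
  Finiteness of the Gaussian integral does not depend on the slice for slice regular
  functions; it is required on every slice here so that no slice has to be singled out.
\<close>

definition fock_slice :: "(quat \<Rightarrow> quat) set" where
  "fock_slice = {f. slice_regular f \<and>
     (\<forall>I\<in>imag_sphere.
        integrable (lborel :: (real \<times> real) measure)
          (\<lambda>(x, y). (norm (f (slice_pt I x y)))\<^sup>2 * exp (- (norm (slice_pt I x y))\<^sup>2)))}"

definition creation :: "(quat \<Rightarrow> quat) \<Rightarrow> quat \<Rightarrow> quat" where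
  "creation f = (\<lambda>q. q * f q)"

definition creation_dom :: "(quat \<Rightarrow> quat) set" where
  "creation_dom = {f \<in> fock_slice. creation f \<in> fock_slice}"


section \<open>Square integrable quaternion-valued functions on the line\<close>

definition square_integrable :: "(real \<Rightarrow> quat) \<Rightarrow> bool" where
  "square_integrable f \<longleftrightarrow>
     f \<in> borel_measurable lborel \<and> integrable lborel (\<lambda>x. (norm (f x))\<^sup>2)"

definition L2_rel :: "(real \<Rightarrow> quat) \<Rightarrow> (real \<Rightarrow> quat) \<Rightarrow> bool" where
  "L2_rel f g \<longleftrightarrow> square_integrable f \<and> square_integrable g \<and> (AE x in lborel. f x = g x)"

lemma square_integrable_zero: "square_integrable (\<lambda>x. 0)"
  by (simp add: square_integrable_def)

lemma square_integrable_scaleR: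
  "square_integrable f \<Longrightarrow> square_integrable (\<lambda>x. c *\<^sub>R f x)"
  by (auto simp: square_integrable_def power_mult_distrib intro: borel_measurable_scaleR)

lemma square_integrable_add:
  assumes "square_integrable f" "square_integrable g"
  shows "square_integrable (\<lambda>x. f x + g x)"
proof -
  have [measurable]: "f \<in> borel_measurable lborel" "g \<in> borel_measurable lborel"
    using assms by (simp_all add: square_integrable_def)
  have "integrable lborel (\<lambda>x. 2 * (norm (f x))\<^sup>2 + 2 * (norm (g x))\<^sup>2)"
    using assms by (auto simp: square_integrable_def)
  then have "integrable lborel (\<lambda>x. (norm (f x + g x))\<^sup>2)"
  proof (rule Bochner_Integration.integrable_bound)
    have "(norm (f x + g x))\<^sup>2 \<le> 2 * (norm (f x))\<^sup>2 + 2 * (norm (g x))\<^sup>2" for x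
    proof -
      have "(norm (f x + g x))\<^sup>2 \<le> (norm (f x) + norm (g x))\<^sup>2"
        by (intro power_mono norm_triangle_ineq) simp
      also have "\<dots> \<le> 2 * (norm (f x))\<^sup>2 + 2 * (norm (g x))\<^sup>2"
        using sum_squares_bound [of "norm (f x)" "norm (g x)"]
        by (simp add: power2_sum)
      finally show ?thesis .
    qed
    then show "AE x in lborel. norm ((norm (f x + g x))\<^sup>2)
                 \<le> norm (2 * (norm (f x))\<^sup>2 + 2 * (norm (g x))\<^sup>2)"
      by simp
  qed measurable
  then show ?thesis
    by (simp add: square_integrable_def)
qed

lemma square_integrable_uminus:
  "square_integrable f \<Longrightarrow> square_integrable (\<lambda>x. - f x)"
  using square_integrable_scaleR [of f "-1"] by simp

lemma square_integrable_diff: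
  "square_integrable f \<Longrightarrow> square_integrable g \<Longrightarrow> square_integrable (\<lambda>x. f x - g x)"
  using square_integrable_add [of f "\<lambda>x. - g x"] square_integrable_uminus [of g] by simp

text \<open>
  The elements of \<open>L2\<close> are classes modulo equality almost everywhere. Borel representatives
  give the same classes as Lebesgue measurable ones.
\<close>

quotient_type L2 = "real \<Rightarrow> quat" / partial: L2_rel
proof (rule part_equivpI)
  show "\<exists>f. L2_rel f f"
    using square_integrable_zero by (auto simp: L2_rel_def)
  show "symp L2_rel"
    by (auto simp: symp_def L2_rel_def)
  show "transp L2_rel"
    by (auto simp: transp_def L2_rel_def)
qed

instantiation L2 :: real_vector
begin

lift_definition zero_L2 :: L2 is "\<lambda>x. 0"
  by (simp add: L2_rel_def square_integrable_zero)

lift_definition plus_L2 :: "L2 \<Rightarrow> L2 \<Rightarrow> L2" is "\<lambda>f g x. f x + g x"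
  by (auto simp: L2_rel_def square_integrable_add)

lift_definition uminus_L2 :: "L2 \<Rightarrow> L2" is "\<lambda>f x. - f x"
  by (auto simp: L2_rel_def square_integrable_uminus)

lift_definition minus_L2 :: "L2 \<Rightarrow> L2 \<Rightarrow> L2" is "\<lambda>f g x. f x - g x"
  by (auto simp: L2_rel_def square_integrable_diff)

lift_definition scaleR_L2 :: "real \<Rightarrow> L2 \<Rightarrow> L2" is "\<lambda>c f x. c *\<^sub>R f x"
  by (auto simp: L2_rel_def square_integrable_scaleR)

instance
proof
  fix u v w :: L2 and a b :: real
  show "u + v + w = u + (v + w)"
    by transfer (auto simp: L2_rel_def add.assoc intro!: square_integrable_add)
  show "u + v = v + u"
    by transfer (auto simp: L2_rel_def add.commute intro!: square_integrable_add)
  show "0 + u = u"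
    by transfer (auto simp: L2_rel_def)
  show "- u + u = 0"
    by transfer (auto simp: L2_rel_def square_integrable_zero)
  show "u - v = u + - v"
    by transfer
      (auto simp: L2_rel_def intro!: square_integrable_diff)
  show "a *\<^sub>R (u + v) = a *\<^sub>R u + a *\<^sub>R v"
    by transfer
      (auto simp: L2_rel_def scaleR_add_right
        intro!: square_integrable_add square_integrable_scaleR)
  show "(a + b) *\<^sub>R u = a *\<^sub>R u + b *\<^sub>R u"
    by transfer
      (auto simp: L2_rel_def scaleR_add_left
        intro!: square_integrable_add square_integrable_scaleR)
  show "a *\<^sub>R b *\<^sub>R u = (a * b) *\<^sub>R u"
    by transfer (auto simp: L2_rel_def intro!: square_integrable_scaleR)
  show "1 *\<^sub>R u = u"
    by transfer (auto simp: L2_rel_def)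
qed

end


section \<open>Position and momentum\<close>

text \<open>
  The unbounded operators are given by their graphs in \<open>L2\<close>: a class belongs to the domain
  iff the prescribed image is represented by a square integrable function.
\<close>

lift_definition position_graph :: "L2 \<Rightarrow> L2 \<Rightarrow> bool" is
  "\<lambda>f g. AE x in lborel. g x = x *\<^sub>R f x"
  by (auto simp: L2_rel_def elim: AE_mp)

definition position_dom :: "L2 set" where
  "position_dom = {\<phi>. \<exists>\<psi>. position_graph \<phi> \<psi>}"

definition position :: "L2 \<Rightarrow> L2" where
  "position \<phi> = (THE \<psi>. position_graph \<phi> \<psi>)"

definition test_function :: "(real \<Rightarrow> real) \<Rightarrow> bool" where
  "test_function \<eta> \<longleftrightarrow>
     (\<forall>n. (deriv ^^ n) \<eta> differentiable_on UNIV) \<and> compact (closure {x. \<eta> x \<noteq> 0})"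

lemma test_function_measurable:
  assumes "test_function \<eta>"
  shows "\<eta> \<in> borel_measurable lborel" "deriv \<eta> \<in> borel_measurable lborel"
proof -
  have "(deriv ^^ n) \<eta> \<in> borel_measurable borel" for n
    using assms unfolding test_function_def
    by (intro borel_measurable_continuous_onI differentiable_imp_continuous_on) blast
  from this [of 0] this [of 1] show
    "\<eta> \<in> borel_measurable lborel" "deriv \<eta> \<in> borel_measurable lborel"
    by simp_all
qed

lemma lborel_integral_scaleR_cong_L2:
  assumes "L2_rel f g" "u \<in> borel_measurable lborel"
  shows "(LINT x|lborel. u x *\<^sub>R f x) = (LINT x|lborel. u x *\<^sub>R g x)"
  using assms
  by (intro integral_cong_AE borel_measurable_scaleR) (auto simp: L2_rel_def square_integrable_def)

lift_definition momentum_graph :: "L2 \<Rightarrow> L2 \<Rightarrow> bool" is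
  "\<lambda>f g. \<forall>\<eta>. test_function \<eta> \<longrightarrow>
     (LINT x|lborel. deriv \<eta> x *\<^sub>R f x) = - (LINT x|lborel. \<eta> x *\<^sub>R g x)"
proof -
  fix f f' g g'
  assume rel: "L2_rel f f'" "L2_rel g g'"
  have "(LINT x|lborel. deriv \<eta> x *\<^sub>R f x) = (LINT x|lborel. deriv \<eta> x *\<^sub>R f' x)"
    if "test_function \<eta>" for \<eta>
    by (rule lborel_integral_scaleR_cong_L2 [OF rel(1) test_function_measurable(2) [OF that]])
  moreover have "(LINT x|lborel. \<eta> x *\<^sub>R g x) = (LINT x|lborel. \<eta> x *\<^sub>R g' x)"
    if "test_function \<eta>" for \<eta>
    by (rule lborel_integral_scaleR_cong_L2 [OF rel(2) test_function_measurable(1) [OF that]])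
  ultimately show "(\<forall>\<eta>. test_function \<eta> \<longrightarrow>
       (LINT x|lborel. deriv \<eta> x *\<^sub>R f x) = - (LINT x|lborel. \<eta> x *\<^sub>R g x)) \<longleftrightarrow>
     (\<forall>\<eta>. test_function \<eta> \<longrightarrow>
       (LINT x|lborel. deriv \<eta> x *\<^sub>R f' x) = - (LINT x|lborel. \<eta> x *\<^sub>R g' x))"
    by auto
qed

definition momentum_dom :: "L2 set" where
  "momentum_dom = {\<phi>. \<exists>\<psi>. momentum_graph \<phi> \<psi>}"

definition momentum :: "L2 \<Rightarrow> L2" where
  "momentum \<phi> = (THE \<psi>. momentum_graph \<phi> \<psi>)"


section \<open>The Segal-Bargmann transform\<close>

definition SB_kernel :: "quat \<Rightarrow> real \<Rightarrow> quat" where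
  "SB_kernel q x =
     (pi powr (- 3/4)) *\<^sub>R
       exp (- ((1/2) *\<^sub>R (q\<^sup>2 + (of_real x)\<^sup>2)) + of_real (sqrt 2) * q * of_real x)"

lemma SB_kernel_measurable: "SB_kernel q \<in> borel_measurable lborel"
proof -
  define g where
    "g x = - ((1/2) *\<^sub>R (q\<^sup>2 + (of_real x)\<^sup>2)) + of_real (sqrt 2) * q * of_real x" for x
  have "(\<lambda>x. g x ^ n /\<^sub>R fact n) \<in> borel_measurable borel" for n
    unfolding g_def by (intro borel_measurable_continuous_onI continuous_intros)
  then have "(\<lambda>x. \<Sum>n. g x ^ n /\<^sub>R fact n) \<in> borel_measurable borel"
    by (rule borel_measurable_suminf)
  then have [measurable]: "(\<lambda>x. exp (g x)) \<in> borel_measurable borel"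
    by (simp only: exp_def)
  have "(\<lambda>x. (pi powr (- 3/4)) *\<^sub>R exp (g x)) \<in> borel_measurable lborel"
    by measurable
  then show ?thesis
    by (simp only: SB_kernel_def [abs_def] g_def)
qed

lift_definition SB :: "L2 \<Rightarrow> quat \<Rightarrow> quat" is
  "\<lambda>f q. LINT x|lborel. SB_kernel q x * f x"
proof -
  fix f g :: "real \<Rightarrow> quat"
  assume fg: "L2_rel f g"
  show "(\<lambda>q. LINT x|lborel. SB_kernel q x * f x) = (\<lambda>q. LINT x|lborel. SB_kernel q x * g x)"
  proof
    fix q
    have "f \<in> borel_measurable lborel" "g \<in> borel_measurable lborel" "AE x in lborel. f x = g x"
      using fg by (auto simp: L2_rel_def square_integrable_def)
    then show "(LINT x|lborel. SB_kernel q x * f x) = (LINT x|lborel. SB_kernel q x * g x)"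
      by (intro integral_cong_AE borel_measurable_times SB_kernel_measurable) auto
  qed
qed

end

theory Submission
  imports Defs "HOL-Probability.Probability" "HOL-Complex_Analysis.Complex_Analysis"
begin

text \<open>
  Split \<open>\<phi>\<close> into its four real components. On the slice of \<open>I\<close> the transform of each component is
  the complex Segal--Bargmann transform, an entire function, with \<open>\<i>\<close> replaced by \<open>I\<close>. An identity
  between transforms therefore only has to be checked at real \<open>q\<close>, where the kernel is a real
  Gaussian in \<open>x\<close>. There \<open>q \<cdot> SB \<phi> q = SB (1/\<surd>2 (X - D) \<phi>) q\<close> is one integration by parts against
  that Gaussian, obtained from the weak derivative by a smooth cutoff. Injectivity holds because
  vanishing at real \<open>q\<close> forces vanishing at imaginary \<open>q\<close>, that is, of a Fourier transform; the
  same injectivity makes \<open>D\<close> single valued. The Gaussian integral over a slice is bounded by writing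
  the weighted transform at \<open>x + I y\<close> as the Fourier transform at \<open>\<surd>2 y\<close> of
  \<open>t \<mapsto> exp (- (t - \<surd>2 x)\<^sup>2 / 2) \<phi> t\<close> and applying Bessel's inequality in \<open>y\<close>.
\<close>

section \<open>Gaussians and the Fourier transform\<close>

text \<open>Non-commutativity dictates the reduction to components: the kernel at
  \<open>slice_pt I x y\<close> takes values in the plane of I and multiplies from the left, so
  expanding \<phi> in the basis with real coefficients leaves the basis elements on the right, out
  of the way of left multiplication by I and by q. The identity at real r rests on G t = exp (-
  t^2/2 + sqrt 2 r t), for which G' = (sqrt 2 r - t) G. The weak derivative gives - \<integral> G
  D\<phi> = \<integral> G' \<phi>, the two integrals of t G \<phi> contributed by X and by D cancel,
  and \<integral> G (X - D)\<phi> = sqrt 2 r \<integral> G \<phi> remains; this is the sqrt 2 that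
  the factor 1/sqrt 2 removes. Two obstacles shape the analysis. G has no compact support, and
  \<open>test_function\<close> speaks of all iterated derivatives, so the cutoff has to be explicit
  and to lie in a family closed under \<open>deriv\<close>. And square integrability of the Fourier
  transform is not known beforehand, so Bessel's inequality is first proved with a Gaussian weight,
  with a bound independent of its width.\<close>

lemma gaussian_integral:
  fixes \<sigma> :: real
  assumes "\<sigma> > 0"
  shows "has_bochner_integral lborel (\<lambda>t. exp (- (t - m)\<^sup>2 / (2 * \<sigma>\<^sup>2))) (sqrt (2 * pi * \<sigma>\<^sup>2))"
proof -
  have "has_bochner_integral lborel (normal_density m \<sigma>) 1"
    using assms by (simp add: has_bochner_integral_iff)
  from has_bochner_integral_mult_right [OF this, of "sqrt (2 * pi * \<sigma>\<^sup>2)"] show ?thesis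
    using assms by (simp add: normal_density_def)
qed

lemma gaussian_integral_unit:
  fixes m :: real
  shows "has_bochner_integral lborel (\<lambda>t. exp (- (t - m)\<^sup>2)) (sqrt pi)"
  using gaussian_integral [of "1 / sqrt 2" m] by (simp add: power_divide)

lemma normal_density_fourier:
  fixes u \<sigma> :: real
  assumes "\<sigma> > 0"
  shows "(CLBINT y. normal_density 0 \<sigma> y * iexp (y * u)) = exp (- (\<sigma> * u)\<^sup>2 / 2)"
proof -
  have "(CLBINT y. normal_density 0 \<sigma> y * iexp (y * u))
      = \<bar>\<sigma>\<bar> *\<^sub>R (CLBINT y. normal_density 0 \<sigma> (0 + \<sigma> * y) * iexp ((0 + \<sigma> * y) * u))"
    using assms by (intro lborel_integral_real_affine) auto
  also have "\<dots> = (CLBINT y. std_normal_density y *\<^sub>R iexp ((\<sigma> * u) * y))"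
    using assms
    by (subst integral_scaleR_right [symmetric], intro Bochner_Integration.integral_cong)
       (auto simp: normal_density_def real_sqrt_mult scaleR_conv_of_real field_simps power_mult_distrib)
  also have "\<dots> = char std_normal_distribution (\<sigma> * u)"
    unfolding char_def by (subst integral_density) auto
  also have "\<dots> = exp (- (\<sigma> * u)\<^sup>2 / 2)"
    by (simp add: char_std_normal_distribution)
  finally show ?thesis .
qed

text \<open>The square is the transform times its conjugate, written as one integral over the plane.
  There y occurs only in the exponential of i y (s - t), so a later integration over y can be
  carried out first; the second claim supplies the integrability which that exchange
  requires.\<close>

lemma cmod_fourier_squared:
  fixes g :: "real \<Rightarrow> real"
  assumes g: "integrable lborel g"
  shows "complex_of_real ((cmod (CLBINT t. g t * iexp (y * t)))\<^sup>2)
       = (CLINT p|lborel. g (fst p) * g (snd p) * iexp (y * (fst p - snd p)))"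
    and "integrable lborel (\<lambda>p. complex_of_real (g (fst p) * g (snd p)) * iexp (y * (fst p - snd p)))"
proof -
  let ?h = "\<lambda>t. complex_of_real (g t) * iexp (y * t)"
  have [measurable]: "g \<in> borel_measurable borel" using g by auto
  have [measurable]: "cnj \<in> borel_measurable borel"
    by (intro borel_measurable_continuous_onI continuous_intros)
  have h: "integrable lborel ?h"
    by (rule Bochner_Integration.integrable_bound [OF g]) (auto simp: norm_mult)
  have int: "integrable (lborel \<Otimes>\<^sub>M lborel) (case_prod (\<lambda>s t. ?h s * cnj (?h t)))"
  proof (rule lborel_pair.Fubini_integrable)
    show "integrable lborel (\<lambda>x. \<integral>y'. norm (case (x, y') of (s, t) \<Rightarrow> ?h s * cnj (?h t)) \<partial>lborel)"
      using integrable_norm [OF g] by (simp add: norm_mult)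
    show "AE x in lborel. integrable lborel (\<lambda>y'. case (x, y') of (s, t) \<Rightarrow> ?h s * cnj (?h t))"
      using h by (simp del: complex_cnj_mult add: integrable_cnj)
  qed measurable
  have eq: "(\<lambda>p. complex_of_real (g (fst p) * g (snd p)) * iexp (y * (fst p - snd p)))
      = case_prod (\<lambda>s t. ?h s * cnj (?h t))"
  proof -
    have "iexp (y * (s - t)) = iexp (y * s) * cnj (iexp (y * t))" for s t
      by (simp add: exp_cnj mult_exp_exp algebra_simps)
    then show ?thesis
      by (simp add: fun_eq_iff mult_ac)
  qed
  show "integrable lborel (\<lambda>p. complex_of_real (g (fst p) * g (snd p)) * iexp (y * (fst p - snd p)))"
    using int unfolding eq lborel_prod .
  have "complex_of_real ((cmod (integral\<^sup>L lborel ?h))\<^sup>2) = integral\<^sup>L lborel ?h * cnj (integral\<^sup>L lborel ?h)"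
    by (simp only: complex_mult_cnj cmod_power2)
  also have "\<dots> = (\<integral>s. (\<integral>t. ?h s * cnj (?h t) \<partial>lborel) \<partial>lborel)"
    by (simp del: complex_cnj_mult)
  also have "\<dots> = integral\<^sup>L (lborel \<Otimes>\<^sub>M lborel) (case_prod (\<lambda>s t. ?h s * cnj (?h t)))"
    by (rule lborel_pair.integral_fst [OF int])
  finally show "complex_of_real ((cmod (integral\<^sup>L lborel ?h))\<^sup>2)
       = (CLINT p|lborel. g (fst p) * g (snd p) * iexp (y * (fst p - snd p)))"
    unfolding eq lborel_prod by simp
qed

text \<open>
  With a Gaussian weight the squared Fourier transform integrates to a double integral against a
  positive Gaussian kernel in \<open>s - t\<close>, to which the Schur test applies.
\<close>

lemma fourier_gaussian_bound:
  fixes g :: "real \<Rightarrow> real"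
  assumes g: "integrable lborel g" and g2: "integrable lborel (\<lambda>t. (g t)\<^sup>2)" and \<sigma>: "\<sigma> > 0"
  shows "(\<integral>\<^sup>+y. ennreal (exp (- y\<^sup>2 / (2 * \<sigma>\<^sup>2)) * (cmod (CLBINT t. g t * iexp (y * t)))\<^sup>2) \<partial>lborel)
         \<le> ennreal (2 * pi * (LBINT t. (g t)\<^sup>2))"
proof -
  have [measurable]: "g \<in> borel_measurable borel" using g by auto
  define G where "G y = (cmod (CLBINT t. g t * iexp (y * t)))\<^sup>2" for y
  define N where "N = normal_density 0 \<sigma>"
  \<comment> \<open>The Fourier transform of \<open>N\<close>, hence a Gaussian of the reciprocal
    width 1/\<sigma>. Its integral in t does not depend on s, which is what the Schur test
    uses.\<close>
  define E where "E s t = exp (- (s - t)\<^sup>2 / (2 * (1/\<sigma>)\<^sup>2))" for s t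
  have E_int: "(\<integral>\<^sup>+t. ennreal (E s t) \<partial>lborel) = ennreal (sqrt (2 * pi) / \<sigma>)" for s
  proof -
    have "has_bochner_integral lborel (E s) (sqrt (2 * pi) / \<sigma>)"
    proof -
      have "sqrt (2 * pi * (1 / \<sigma>)\<^sup>2) = sqrt (2 * pi) / \<sigma>"
        using \<sigma> by (simp only: real_sqrt_mult real_sqrt_abs) simp
      then show ?thesis
        using gaussian_integral [of "1/\<sigma>" s] \<sigma>
        by (simp add: E_def [abs_def] power2_commute [of s])
    qed
    then show ?thesis
      by (subst nn_integral_eq_integral) (auto simp: has_bochner_integral_iff E_def)
  qed
  have E_sym: "E s t = E t s" for s t
    by (simp add: E_def power2_commute)
  have [measurable]: "case_prod E \<in> borel_measurable (borel \<Otimes>\<^sub>M borel)"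
    unfolding E_def by measurable
  have N_nonneg: "N y \<ge> 0" for y by (simp add: N_def)
  have [measurable]: "N \<in> borel_measurable borel" by (simp add: N_def)
  have N_int: "integrable lborel N" "integral\<^sup>L lborel N = 1"
    using \<sigma> by (auto simp: N_def)
  define P where "P p = g (fst p) * g (snd p)" for p
  define H where "H y p = complex_of_real (N y * P p) * iexp (y * (fst p - snd p))" for y p
  have P_int: "integrable lborel P"
    unfolding P_def using integrable_norm [OF cmod_fourier_squared(2) [OF g, of 0]]
    by (subst integrable_norm_iff [symmetric]) (auto simp: abs_mult norm_mult lborel_prod [symmetric])
  have [measurable]: "P \<in> borel_measurable borel" using P_int by auto
  have H_meas [measurable]: "case_prod H \<in> borel_measurable (lborel \<Otimes>\<^sub>M lborel)"
  proof -
    have [measurable]: "fst \<in> borel_measurable (borel :: (real \<times> real) measure)"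
       "snd \<in> borel_measurable (borel :: (real \<times> real) measure)"
      by (auto intro!: borel_measurable_continuous_onI continuous_intros)
    show ?thesis unfolding H_def by measurable
  qed
  have H_int: "integrable (lborel \<Otimes>\<^sub>M lborel) (case_prod H)"
  proof (rule lborel_pair.Fubini_integrable [OF H_meas])
    show "integrable lborel (\<lambda>y. \<integral>p. norm (case (y, p) of (y, p) \<Rightarrow> H y p) \<partial>lborel)"
      using N_int(1) N_nonneg by (simp add: H_def norm_mult abs_mult)
    show "AE y in lborel. integrable lborel (\<lambda>p. case (y, p) of (y, p) \<Rightarrow> H y p)"
    proof (rule AE_I2)
      fix y
      have "integrable lborel (\<lambda>p. complex_of_real (N y) * (complex_of_real (P p) * iexp (y * (fst p - snd p))))"
        using cmod_fourier_squared(2) [OF g, of y] unfolding P_def by (rule integrable_mult_right)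
      then show "integrable lborel (\<lambda>p. case (y, p) of (y, p) \<Rightarrow> H y p)"
        by (simp add: H_def mult.assoc)
    qed
  qed
  have HG: "(\<integral>p. H y p \<partial>lborel) = complex_of_real (N y * G y)" for y
  proof -
    have "(\<integral>p. H y p \<partial>lborel) = complex_of_real (N y) * (CLINT p|lborel. P p * iexp (y * (fst p - snd p)))"
      unfolding H_def of_real_mult mult.assoc by (rule integral_mult_right_zero)
    also have "\<dots> = complex_of_real (N y * G y)"
      unfolding P_def G_def of_real_mult [of "N y"] cmod_fourier_squared(1) [OF g, of y] ..
    finally show ?thesis .
  qed
  have NG_int: "integrable lborel (\<lambda>y. N y * G y)"
    using integrable_Re [OF lborel_pair.integrable_fst' [OF H_int]] by (simp add: HG)
  have HN: "(\<integral>y. H y p \<partial>lborel) = complex_of_real (P p * E (fst p) (snd p))" for p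
  proof -
    have "(\<integral>y. H y p \<partial>lborel) = complex_of_real (P p) * (CLBINT y. N y * iexp (y * (fst p - snd p)))"
      by (subst integral_mult_right_zero [symmetric]) (simp add: H_def mult_ac)
    then show ?thesis
      unfolding N_def normal_density_fourier [OF \<sigma>]
      by (simp add: E_def power_mult_distrib power_divide mult.commute del: of_real_exp)
  qed
  have "complex_of_real (LBINT y. N y * G y) = (\<integral>y. \<integral>p. H y p \<partial>lborel \<partial>lborel)"
    by (simp add: HG del: of_real_mult)
  also have "\<dots> = (\<integral>p. \<integral>y. H y p \<partial>lborel \<partial>lborel)"
    using lborel_pair.Fubini_integral [OF H_int] by simp
  also have "\<dots> = complex_of_real (\<integral>p. P p * E (fst p) (snd p) \<partial>lborel)"
    by (simp add: HN del: of_real_mult)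
  finally have NG: "(LBINT y. N y * G y) = (\<integral>p. P p * E (fst p) (snd p) \<partial>lborel)"
    by (simp only: of_real_eq_iff)
  define B where "B = (LBINT t. (g t)\<^sup>2)"
  have B: "(\<integral>\<^sup>+t. ennreal ((g t)\<^sup>2) \<partial>lborel) = ennreal B" "B \<ge> 0"
    unfolding B_def using g2 by (auto intro: nn_integral_eq_integral)
  have half: "(\<integral>\<^sup>+s. \<integral>\<^sup>+t. ennreal ((g s)\<^sup>2 / 2 * E s t) \<partial>lborel \<partial>lborel)
      = ennreal (B * (sqrt (2 * pi) / \<sigma>) / 2)"
  proof -
    have "(\<integral>\<^sup>+s. \<integral>\<^sup>+t. ennreal ((g s)\<^sup>2 / 2 * E s t) \<partial>lborel \<partial>lborel)
       = (\<integral>\<^sup>+s. ennreal ((g s)\<^sup>2) * ennreal (sqrt (2 * pi) / \<sigma> / 2) \<partial>lborel)"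
    proof (rule nn_integral_cong)
      fix s
      have "(\<integral>\<^sup>+t. ennreal ((g s)\<^sup>2 / 2 * E s t) \<partial>lborel) = ennreal ((g s)\<^sup>2 / 2) * (\<integral>\<^sup>+t. ennreal (E s t) \<partial>lborel)"
        by (subst nn_integral_cmult [symmetric])
          (auto simp: ennreal_mult [symmetric] E_def intro!: nn_integral_cong)
      then show "(\<integral>\<^sup>+t. ennreal ((g s)\<^sup>2 / 2 * E s t) \<partial>lborel) = ennreal ((g s)\<^sup>2) * ennreal (sqrt (2 * pi) / \<sigma> / 2)"
        using \<sigma> by (simp add: E_int ennreal_mult [symmetric])
    qed
    also have "\<dots> = ennreal B * ennreal (sqrt (2 * pi) / \<sigma> / 2)"
      by (subst nn_integral_multc) (auto simp: B)
    finally show ?thesis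
      using B \<sigma> by (simp add: ennreal_mult [symmetric])
  qed
  have "(\<integral>\<^sup>+y. ennreal (N y * G y) \<partial>lborel) = ennreal (LBINT y. N y * G y)"
    using NG_int N_nonneg by (intro nn_integral_eq_integral) (auto simp: G_def)
  also have "\<dots> \<le> (\<integral>\<^sup>+p. ennreal \<bar>P p * E (fst p) (snd p)\<bar> \<partial>lborel)"
  proof -
    have "integrable lborel (\<lambda>p. P p * E (fst p) (snd p))"
      using integrable_Re [OF lborel_pair.integrable_snd [OF H_int]]
      by (simp add: HN)
    from integral_norm_bound_ennreal [OF this] show ?thesis
      unfolding NG using order_trans [OF ennreal_leI [OF abs_ge_self]] by auto
  qed
  also have "\<dots> \<le> (\<integral>\<^sup>+p. ennreal ((g (fst p))\<^sup>2 / 2 * E (fst p) (snd p)) + ennreal ((g (snd p))\<^sup>2 / 2 * E (snd p) (fst p)) \<partial>lborel)"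
  proof (rule nn_integral_mono)
    fix p
    have "\<bar>P p * E (fst p) (snd p)\<bar> = \<bar>g (fst p)\<bar> * \<bar>g (snd p)\<bar> * E (fst p) (snd p)"
      by (simp add: P_def E_def abs_mult)
    also have "\<dots> \<le> ((g (fst p))\<^sup>2 / 2 + (g (snd p))\<^sup>2 / 2) * E (fst p) (snd p)"
      using sum_squares_bound [of "\<bar>g (fst p)\<bar>" "\<bar>g (snd p)\<bar>"]
      by (intro mult_right_mono) (auto simp: E_def)
    also have "\<dots> = (g (fst p))\<^sup>2 / 2 * E (fst p) (snd p) + (g (snd p))\<^sup>2 / 2 * E (snd p) (fst p)"
      by (simp add: E_sym [of "snd p"] distrib_right)
    finally have "ennreal \<bar>P p * E (fst p) (snd p)\<bar>
       \<le> ennreal ((g (fst p))\<^sup>2 / 2 * E (fst p) (snd p) + (g (snd p))\<^sup>2 / 2 * E (snd p) (fst p))"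
      by (rule ennreal_leI)
    also have "\<dots> = ennreal ((g (fst p))\<^sup>2 / 2 * E (fst p) (snd p)) + ennreal ((g (snd p))\<^sup>2 / 2 * E (snd p) (fst p))"
      by (rule ennreal_plus) (auto simp: E_def)
    finally show "ennreal \<bar>P p * E (fst p) (snd p)\<bar>
       \<le> ennreal ((g (fst p))\<^sup>2 / 2 * E (fst p) (snd p)) + ennreal ((g (snd p))\<^sup>2 / 2 * E (snd p) (fst p))" .
  qed
  also have "\<dots> = (\<integral>\<^sup>+p. ennreal ((g (fst p))\<^sup>2 / 2 * E (fst p) (snd p)) + ennreal ((g (snd p))\<^sup>2 / 2 * E (snd p) (fst p))
       \<partial>(lborel \<Otimes>\<^sub>M lborel))"
    by (simp add: lborel_prod)
  also have "\<dots> = (\<integral>\<^sup>+p. ennreal ((g (fst p))\<^sup>2 / 2 * E (fst p) (snd p)) \<partial>(lborel \<Otimes>\<^sub>M lborel))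
      + (\<integral>\<^sup>+p. ennreal ((g (snd p))\<^sup>2 / 2 * E (snd p) (fst p)) \<partial>(lborel \<Otimes>\<^sub>M lborel))"
    by (rule nn_integral_add) measurable
  also have "(\<integral>\<^sup>+p. ennreal ((g (fst p))\<^sup>2 / 2 * E (fst p) (snd p)) \<partial>(lborel \<Otimes>\<^sub>M lborel))
      = ennreal (B * (sqrt (2 * pi) / \<sigma>) / 2)"
    unfolding half [symmetric]
    by (subst lborel.nn_integral_fst [symmetric]) auto
  also have "(\<integral>\<^sup>+p. ennreal ((g (snd p))\<^sup>2 / 2 * E (snd p) (fst p)) \<partial>(lborel \<Otimes>\<^sub>M lborel))
      = ennreal (B * (sqrt (2 * pi) / \<sigma>) / 2)"
    unfolding half [symmetric]
    by (subst lborel_pair.nn_integral_snd [symmetric]) auto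
  also have "ennreal (B * (sqrt (2 * pi) / \<sigma>) / 2) + ennreal (B * (sqrt (2 * pi) / \<sigma>) / 2)
      = ennreal (B * (sqrt (2 * pi) / \<sigma>))"
    using B \<sigma> by (subst ennreal_plus [symmetric]) auto
  finally have le: "(\<integral>\<^sup>+y. ennreal (N y * G y) \<partial>lborel) \<le> ennreal (B * (sqrt (2 * pi) / \<sigma>))" .
  have [measurable]: "(\<lambda>y. N y * G y) \<in> borel_measurable borel" using NG_int by auto
  \<comment> \<open>Undoing the normalisation of \<open>N\<close> costs sqrt (2 pi) \<sigma>, and
    the mass of \<open>E\<close> is sqrt (2 pi) / \<sigma>. The width cancels, leaving 2 pi.\<close>
  have "(\<integral>\<^sup>+y. ennreal (exp (- y\<^sup>2 / (2 * \<sigma>\<^sup>2)) * G y) \<partial>lborel)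
      = (\<integral>\<^sup>+y. ennreal (sqrt (2 * pi) * \<sigma>) * ennreal (N y * G y) \<partial>lborel)"
    using \<sigma> by (intro nn_integral_cong, subst ennreal_mult [symmetric])
      (auto simp: N_def normal_density_def G_def real_sqrt_mult)
  also have "\<dots> = ennreal (sqrt (2 * pi) * \<sigma>) * (\<integral>\<^sup>+y. ennreal (N y * G y) \<partial>lborel)"
    by (rule nn_integral_cmult) measurable
  also have "\<dots> \<le> ennreal (sqrt (2 * pi) * \<sigma>) * ennreal (B * (sqrt (2 * pi) / \<sigma>))"
    using le by (intro mult_left_mono) auto
  also have "\<dots> = ennreal (2 * pi * B)"
    using \<sigma> B by (subst ennreal_mult [symmetric]) auto
  finally show ?thesis
    unfolding G_def B_def .
qed

text \<open>The weights exp (- y^2 / (2 \<sigma>^2)) with \<sigma> = n + 1 tend to 1, and the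
  weighted bound is uniform in \<sigma>, so Fatou's lemma removes them. This is the inequality half
  of Plancherel's theorem.\<close>

lemma fourier_L2_bound:
  fixes g :: "real \<Rightarrow> real"
  assumes g: "integrable lborel g" and g2: "integrable lborel (\<lambda>t. (g t)\<^sup>2)"
  shows "(\<integral>\<^sup>+y. ennreal ((cmod (CLBINT t. g t * iexp (y * t)))\<^sup>2) \<partial>lborel)
         \<le> ennreal (2 * pi * (LBINT t. (g t)\<^sup>2))"
proof -
  have [measurable]: "g \<in> borel_measurable borel" using g by auto
  define G where "G y = (cmod (CLBINT t. g t * iexp (y * t)))\<^sup>2" for y
  have [measurable]: "G \<in> borel_measurable borel"
    unfolding G_def by measurable
  define W where "W n y = ennreal (exp (- y\<^sup>2 / (2 * (real (Suc n))\<^sup>2)) * G y)" for n y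
  have lim: "(\<lambda>n. W n y) \<longlonglongrightarrow> ennreal (G y)" for y
  proof -
    have "(\<lambda>n. exp (- y\<^sup>2 / (2 * (real (Suc n))\<^sup>2)) * G y) \<longlonglongrightarrow> exp 0 * G y"
      by real_asymp
    then show ?thesis
      unfolding W_def by (intro tendsto_ennrealI) simp
  qed
  have "(\<integral>\<^sup>+y. ennreal (G y) \<partial>lborel) = (\<integral>\<^sup>+y. liminf (\<lambda>n. W n y) \<partial>lborel)"
    by (simp add: lim_imp_Liminf [OF trivial_limit_sequentially lim])
  also have "\<dots> \<le> liminf (\<lambda>n. \<integral>\<^sup>+y. W n y \<partial>lborel)"
    by (rule nn_integral_liminf) (simp add: W_def)
  also have "\<dots> \<le> ennreal (2 * pi * (LBINT t. (g t)\<^sup>2))"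
    using fourier_gaussian_bound [OF g g2]
    by (intro Liminf_le always_eventually) (auto simp: W_def G_def)
  finally show ?thesis
    by (simp add: G_def)
qed

section \<open>Uniqueness for the Fourier transform of integrable functions\<close>

lemma prob_density_char:
  fixes p :: "real \<Rightarrow> real"
  assumes p: "integrable lborel p" "\<And>t. p t \<ge> 0" "integral\<^sup>L lborel p = 1"
  shows "real_distribution (density lborel (\<lambda>t. ennreal (p t)))"
    and "char (density lborel (\<lambda>t. ennreal (p t))) y = (CLBINT t. p t * iexp (y * t))"
proof -
  have [measurable]: "p \<in> borel_measurable borel" using p by auto
  show "char (density lborel (\<lambda>t. ennreal (p t))) y = (CLBINT t. p t * iexp (y * t))"
    unfolding char_def using p(2)
    by (subst integral_density) (auto simp: scaleR_conv_of_real)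
  have "(\<integral>\<^sup>+t. ennreal (p t) \<partial>lborel) = 1"
    using p by (subst nn_integral_eq_integral) auto
  then show "real_distribution (density lborel (\<lambda>t. ennreal (p t)))"
    by (auto simp: real_distribution_def real_distribution_axioms_def emeasure_density
        intro!: prob_spaceI)
qed

text \<open>Levy's uniqueness theorem speaks of probability measures, so g is split into its
  positive and negative parts. Their transforms agree, the value at y = 0 shows that they have the
  same mass c, and after division by c they are densities with equal characteristic functions. If c
  = 0, both parts vanish almost everywhere at once.\<close>

lemma fourier_eq_zero_imp_AE_zero:
  fixes g :: "real \<Rightarrow> real"
  assumes g: "integrable lborel g" and zero: "\<And>y. (CLBINT t. g t * iexp (y * t)) = 0"
  shows "AE t in lborel. g t = 0"
proof -
  have [measurable]: "g \<in> borel_measurable borel" using g by auto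
  define p n where "p t = max 0 (g t)" and "n t = max 0 (- g t)" for t
  have int: "integrable lborel p" "integrable lborel n"
    using g by (auto simp: p_def [abs_def] n_def [abs_def])
  have nonneg: "p t \<ge> 0" "n t \<ge> 0" for t by (auto simp: p_def n_def)
  have g_eq: "g t = p t - n t" for t by (auto simp: p_def n_def)
  have fourier: "(CLBINT t. p t * iexp (y * t)) = (CLBINT t. n t * iexp (y * t))" for y
  proof -
    have "integrable lborel (\<lambda>t. p t * iexp (y * t))"
      by (rule Bochner_Integration.integrable_bound [OF int(1)]) (auto simp: norm_mult p_def)
    moreover have "integrable lborel (\<lambda>t. n t * iexp (y * t))"
      by (rule Bochner_Integration.integrable_bound [OF int(2)]) (auto simp: norm_mult n_def)
    ultimately have "(CLBINT t. p t * iexp (y * t)) - (CLBINT t. n t * iexp (y * t)) = (CLBINT t. g t * iexp (y * t))"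
      by (subst Bochner_Integration.integral_diff [symmetric]) (auto simp: g_eq left_diff_distrib)
    with zero [of y] show ?thesis by simp
  qed
  define c where "c = integral\<^sup>L lborel p"
  have c: "integral\<^sup>L lborel n = c"
    using fourier [of 0] by (simp add: c_def)
  show ?thesis
  proof (cases "c = 0")
    case True
    then have "AE t in lborel. p t = 0" "AE t in lborel. n t = 0"
      using int nonneg c integral_nonneg_eq_0_iff_AE [OF int(1)] integral_nonneg_eq_0_iff_AE [OF int(2)]
      by (auto simp: c_def)
    then show ?thesis by eventually_elim (simp add: g_eq)
  next
    case False
    then have c_pos: "c > 0"
      using nonneg Bochner_Integration.integral_nonneg [of lborel p] by (simp add: c_def less_le)
    have int': "integrable lborel (\<lambda>t. p t / c)" "integrable lborel (\<lambda>t. n t / c)"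
      "\<And>t. p t / c \<ge> 0" "\<And>t. n t / c \<ge> 0"
      "(LBINT t. p t / c) = 1" "(LBINT t. n t / c) = 1"
      using int nonneg c c_pos by (auto simp: c_def)
    have "density lborel (\<lambda>t. ennreal (p t / c)) = density lborel (\<lambda>t. ennreal (n t / c))"
    proof (rule Levy_uniqueness)
      show "char (density lborel (\<lambda>t. ennreal (p t / c))) = char (density lborel (\<lambda>t. ennreal (n t / c)))"
      proof
        fix y
        have "(CLBINT t. complex_of_real (p t / c) * iexp (y * t)) = (CLBINT t. p t * iexp (y * t)) / c"
             "(CLBINT t. complex_of_real (n t / c) * iexp (y * t)) = (CLBINT t. n t * iexp (y * t)) / c"
          by (subst integral_divide_zero [symmetric], simp)+
        then show "char (density lborel (\<lambda>t. ennreal (p t / c))) y = char (density lborel (\<lambda>t. ennreal (n t / c))) y"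
          by (simp only: prob_density_char(2) [OF int'(1,3,5)] prob_density_char(2) [OF int'(2,4,6)] fourier)
      qed
    qed (auto intro!: prob_density_char(1) int')
    then have "AE t in lborel. ennreal (p t / c) = ennreal (n t / c)"
      by (intro sigma_finite_measure.density_unique [OF sigma_finite_lborel]) (auto simp: p_def n_def)
    then show ?thesis
      using c_pos nonneg by (auto simp: g_eq ennreal_inj elim!: eventually_mono)
  qed
qed

section \<open>The transform of a real component\<close>

definition real_L2 :: "(real \<Rightarrow> real) \<Rightarrow> bool" where
  "real_L2 f \<longleftrightarrow> f \<in> borel_measurable borel \<and> integrable lborel (\<lambda>t. (f t)\<^sup>2)"

lemma real_L2_measurable [measurable_dest]: "real_L2 f \<Longrightarrow> f \<in> borel_measurable borel"
  by (simp add: real_L2_def)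

text \<open>By 2 a b \<le> a^2 + b^2 the product is dominated by f^2 plus the square of the weight.
  That square is exp (2 c |t| - t^2), and since |t| is t or -t, completing the square bounds it by
  exp (c^2) times two unit Gaussians centred at c and -c.\<close>

lemma real_L2_exp_gaussian_integrable:
  assumes f: "real_L2 f"
  shows "integrable lborel (\<lambda>t. exp (c * \<bar>t\<bar>) * exp (- t\<^sup>2 / 2) * f t)"
proof -
  note [measurable] = real_L2_measurable [OF f]
  have "integrable lborel (\<lambda>t. exp (c\<^sup>2) * (exp (- (t - c)\<^sup>2) + exp (- (t - (- c))\<^sup>2)) + (f t)\<^sup>2)"
    using gaussian_integral_unit [of c] gaussian_integral_unit [of "- c"] f
    by (auto simp only: real_L2_def has_bochner_integral_iff
        intro!: Bochner_Integration.integrable_add integrable_mult_right)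
  then show ?thesis
  proof (rule Bochner_Integration.integrable_bound)
    have "\<bar>exp (c * \<bar>t\<bar>) * exp (- t\<^sup>2 / 2) * f t\<bar>
        \<le> exp (c\<^sup>2) * (exp (- (t - c)\<^sup>2) + exp (- (t - (- c))\<^sup>2)) + (f t)\<^sup>2" for t
    proof -
      let ?u = "exp (c * \<bar>t\<bar>) * exp (- t\<^sup>2 / 2)"
      have "2 * (?u * \<bar>f t\<bar>) \<le> ?u\<^sup>2 + (f t)\<^sup>2"
        using sum_squares_bound [of ?u "\<bar>f t\<bar>"] by (simp only: mult.assoc power2_abs)
      moreover have "?u * \<bar>f t\<bar> \<ge> 0" by simp
      ultimately have "?u * \<bar>f t\<bar> \<le> ?u\<^sup>2 + (f t)\<^sup>2"
        by linarith
      moreover have "?u\<^sup>2 = exp (2 * c * \<bar>t\<bar> - t\<^sup>2)"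
        by (simp add: power_mult_distrib exp_double [symmetric] mult_exp_exp algebra_simps)
      moreover have "exp (2 * c * \<bar>t\<bar> - t\<^sup>2) \<le> exp (2 * c * t - t\<^sup>2) + exp (- 2 * c * t - t\<^sup>2)"
        by (cases "t \<ge> 0") (auto simp: add_increasing add_increasing2)
      moreover have "exp (2 * c * t - t\<^sup>2) + exp (- 2 * c * t - t\<^sup>2)
          = exp (c\<^sup>2) * (exp (- (t - c)\<^sup>2) + exp (- (t - (- c))\<^sup>2))"
        by (simp add: distrib_left mult_exp_exp) (simp add: power2_eq_square algebra_simps)
      ultimately show ?thesis
        by (simp add: abs_mult)
    qed
    then show "AE t in lborel. norm (exp (c * \<bar>t\<bar>) * exp (- t\<^sup>2 / 2) * f t)
        \<le> norm (exp (c\<^sup>2) * (exp (- (t - c)\<^sup>2) + exp (- (t - (- c))\<^sup>2)) + (f t)\<^sup>2)"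
      by (auto intro!: AE_I2 order_trans [OF _ abs_ge_self])
  qed measurable
qed

lemma real_L2_scaleR_integrable:
  fixes h :: "real \<Rightarrow> 'b :: {banach, second_countable_topology}"
  assumes f: "real_L2 f" and [measurable]: "h \<in> borel_measurable borel"
    and le: "\<And>t. norm (h t) \<le> K * (exp (c * \<bar>t\<bar>) * exp (- t\<^sup>2 / 2))"
  shows "integrable lborel (\<lambda>t. f t *\<^sub>R h t)"
proof (rule Bochner_Integration.integrable_bound [OF integrable_mult_right])
  note [measurable] = real_L2_measurable [OF f]
  show "integrable lborel (\<lambda>t. exp (c * \<bar>t\<bar>) * exp (- t\<^sup>2 / 2) * f t)"
    by (rule real_L2_exp_gaussian_integrable [OF f])
  show "(\<lambda>t. f t *\<^sub>R h t) \<in> borel_measurable lborel" by measurable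
  have "norm (f t *\<^sub>R h t) \<le> norm (\<bar>K\<bar> * (exp (c * \<bar>t\<bar>) * exp (- t\<^sup>2 / 2) * f t))" for t
  proof -
    have "norm (f t *\<^sub>R h t) \<le> \<bar>f t\<bar> * (K * (exp (c * \<bar>t\<bar>) * exp (- t\<^sup>2 / 2)))"
      using le [of t] by (simp add: mult_left_mono)
    also have "\<dots> \<le> \<bar>f t\<bar> * (\<bar>K\<bar> * (exp (c * \<bar>t\<bar>) * exp (- t\<^sup>2 / 2)))"
      by (intro mult_left_mono mult_right_mono) auto
    finally show ?thesis by (simp add: abs_mult mult_ac)
  qed
  then show "AE t in lborel. norm (f t *\<^sub>R h t) \<le> norm (\<bar>K\<bar> * (exp (c * \<bar>t\<bar>) * exp (- t\<^sup>2 / 2) * f t))"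
    by auto
qed

definition SB_kernel_complex :: "complex \<Rightarrow> real \<Rightarrow> complex" where
  "SB_kernel_complex z t = of_real (pi powr (- 3/4)) *
     exp (- ((z\<^sup>2 + (of_real t)\<^sup>2) / 2) + of_real (sqrt 2) * z * of_real t)"

definition SB_component :: "(real \<Rightarrow> real) \<Rightarrow> complex \<Rightarrow> complex" where
  "SB_component f z = (CLBINT t. f t *\<^sub>R SB_kernel_complex z t)"

text \<open>Pulling out exp (- z^2 / 2), which is free of t and never zero, leaves a two-sided
  Laplace integral of f t exp (- t^2 / 2). Holomorphy and the passage to a Fourier transform concern
  only that integral.\<close>

lemma SB_kernel_complex_factor:
  "SB_kernel_complex z t = of_real (pi powr (- 3/4)) * exp (- z\<^sup>2 / 2) *
     (exp (of_real (sqrt 2) * z * of_real t) * of_real (exp (- t\<^sup>2 / 2)))"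
  unfolding SB_kernel_complex_def exp_of_real [symmetric]
  by (simp add: mult_exp_exp algebra_simps add_divide_distrib)

lemma SB_kernel_complex_measurable [measurable]: "SB_kernel_complex z \<in> borel_measurable borel"
  unfolding SB_kernel_complex_def by measurable

lemma norm_exp_linear_le:
  "norm (exp (of_real (sqrt 2) * z * of_real t :: complex)) \<le> exp (sqrt 2 * norm z * \<bar>t\<bar>)"
  using complex_Re_le_cmod [of "of_real (sqrt 2) * z * of_real t"] by (simp add: norm_mult)

lemma norm_SB_kernel_complex_le:
  "norm (SB_kernel_complex z t) \<le> (pi powr (- 3/4) * norm (exp (- z\<^sup>2 / 2))) *
     (exp ((sqrt 2 * norm z) * \<bar>t\<bar>) * exp (- t\<^sup>2 / 2))"
  unfolding SB_kernel_complex_factor using norm_exp_linear_le [of z t]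
  by (simp add: norm_mult mult_left_mono)

lemma SB_component_integrable:
  "real_L2 f \<Longrightarrow> integrable lborel (\<lambda>t. f t *\<^sub>R SB_kernel_complex z t)"
  by (rule real_L2_scaleR_integrable [OF _ _ norm_SB_kernel_complex_le]) measurable

lemma SB_component_factor:
  "SB_component f z = of_real (pi powr (- 3/4)) * exp (- z\<^sup>2 / 2) *
     (CLBINT t. f t *\<^sub>R (exp (of_real (sqrt 2) * z * of_real t) * of_real (exp (- t\<^sup>2 / 2))))"
  unfolding SB_component_def SB_kernel_complex_factor
  by (subst integral_mult_right_zero [symmetric]) (simp add: scaleR_conv_of_real mult_ac)

text \<open>The factor exp (sqrt 2 z t) is expanded under the integral, which exhibits the integral
  \<open>L\<close> as a power series in z whose coefficients are Gaussian moments of f. The norms of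
  the terms form the exponential series of sqrt 2 |z| |t|, so \<open>partial\<close> and
  \<open>dom\<close> together give the domination that justifies termwise integration.\<close>

lemma SB_component_holomorphic:
  assumes f: "real_L2 f"
  shows "SB_component f holomorphic_on UNIV"
proof -
  note [measurable] = real_L2_measurable [OF f]
  define g where "g n t = (sqrt 2 * t) ^ n / fact n * exp (- t\<^sup>2 / 2) * f t" for n :: nat and t
  define L where "L z = (CLBINT t. f t *\<^sub>R (exp (of_real (sqrt 2) * z * of_real t) * of_real (exp (- t\<^sup>2 / 2))))" for z
  have [measurable]: "g n \<in> borel_measurable borel" for n
    unfolding g_def by measurable
  have partial: "(\<Sum>n<k. norm (z ^ n * of_real (g n t))) \<le> exp (sqrt 2 * norm z * \<bar>t\<bar>) * exp (- t\<^sup>2 / 2) * \<bar>f t\<bar>"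
    for k t and z :: complex
  proof -
    have "norm (z ^ n * of_real (g n t)) = (sqrt 2 * norm z * \<bar>t\<bar>) ^ n /\<^sub>R fact n * (exp (- t\<^sup>2 / 2) * \<bar>f t\<bar>)" for n
    proof -
      have "\<bar>P / fact n * exp e * w\<bar> = \<bar>P\<bar> / fact n * exp e * \<bar>w\<bar>" for P e w :: real
        by (simp add: abs_mult)
      moreover have "\<bar>(sqrt 2 * t) ^ n\<bar> = (sqrt 2 * \<bar>t\<bar>) ^ n"
        by (simp add: power_abs abs_mult)
      ultimately have "\<bar>g n t\<bar> = (sqrt 2 * \<bar>t\<bar>) ^ n / fact n * exp (- t\<^sup>2 / 2) * \<bar>f t\<bar>"
        by (simp only: g_def)
      then show ?thesis
        by (simp only: norm_mult norm_power norm_of_real)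
          (simp only: power_mult_distrib divide_inverse real_scaleR_def mult_ac)
    qed
    then have "(\<Sum>n<k. norm (z ^ n * of_real (g n t)))
        = (\<Sum>n<k. (sqrt 2 * norm z * \<bar>t\<bar>) ^ n /\<^sub>R fact n) * (exp (- t\<^sup>2 / 2) * \<bar>f t\<bar>)"
      by (simp only: sum_distrib_right)
    also have "\<dots> \<le> exp (sqrt 2 * norm z * \<bar>t\<bar>) * (exp (- t\<^sup>2 / 2) * \<bar>f t\<bar>)"
      by (intro mult_right_mono sum_le_suminf [OF sums_summable [OF exp_converges], folded sums_unique [OF exp_converges]]) auto
    finally show ?thesis by (simp add: mult.assoc)
  qed
  have dom: "integrable lborel (\<lambda>t. exp (sqrt 2 * norm z * \<bar>t\<bar>) * exp (- t\<^sup>2 / 2) * \<bar>f t\<bar>)" for z :: complex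
    using integrable_norm [OF real_L2_exp_gaussian_integrable [OF f, of "sqrt 2 * norm z"]]
    by (simp add: abs_mult)
  have int: "integrable lborel (\<lambda>t. z ^ n * complex_of_real (g n t))" for n z
  proof (rule Bochner_Integration.integrable_bound [OF dom [of z]])
    have "norm (z ^ n * complex_of_real (g n t)) \<le> exp (sqrt 2 * norm z * \<bar>t\<bar>) * exp (- t\<^sup>2 / 2) * \<bar>f t\<bar>" for t
      using partial [where k = "Suc n" and t = t and z = z] sum_nonneg [of "{..<n}" "\<lambda>n. norm (z ^ n * of_real (g n t))"]
      unfolding sum.lessThan_Suc by (smt (verit) norm_ge_zero)
    then show "AE t in lborel. norm (z ^ n * complex_of_real (g n t))
        \<le> norm (exp (sqrt 2 * norm z * \<bar>t\<bar>) * exp (- t\<^sup>2 / 2) * \<bar>f t\<bar>)"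
      by (simp add: abs_mult)
  qed measurable
  have sums: "(\<lambda>n. (CLBINT t. z ^ n * complex_of_real (g n t))) sums (CLBINT t. (\<Sum>n. z ^ n * complex_of_real (g n t)))" for z
  proof (rule sums_integral)
    show "integrable lborel (\<lambda>t. z ^ n * complex_of_real (g n t))" for n
      by (rule int)
    show "AE t in lborel. summable (\<lambda>n. norm (z ^ n * complex_of_real (g n t)))"
      using partial by (intro AE_I2 summableI_nonneg_bounded) auto
    show "summable (\<lambda>n. LBINT t. norm (z ^ n * complex_of_real (g n t)))"
    proof (rule summableI_nonneg_bounded)
      show "(\<Sum>n<k. LBINT t. norm (z ^ n * complex_of_real (g n t)))
          \<le> (LBINT t. exp (sqrt 2 * norm z * \<bar>t\<bar>) * exp (- t\<^sup>2 / 2) * \<bar>f t\<bar>)" for k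
      proof -
        have "(\<Sum>n<k. LBINT t. norm (z ^ n * complex_of_real (g n t)))
            = (LBINT t. (\<Sum>n<k. norm (z ^ n * complex_of_real (g n t))))"
          by (rule Bochner_Integration.integral_sum [symmetric]) (rule integrable_norm [OF int])
        also have "\<dots> \<le> (LBINT t. exp (sqrt 2 * norm z * \<bar>t\<bar>) * exp (- t\<^sup>2 / 2) * \<bar>f t\<bar>)"
          by (intro integral_mono Bochner_Integration.integrable_sum integrable_norm int dom partial)
        finally show ?thesis .
      qed
    qed simp
  qed
  have ptwise: "(\<Sum>n. z ^ n * complex_of_real (g n t)) = f t *\<^sub>R (exp (of_real (sqrt 2) * z * of_real t) * of_real (exp (- t\<^sup>2 / 2)))" for z t
  proof -
    have "(of_real (sqrt 2) * z * of_real t) ^ n /\<^sub>R fact n * complex_of_real (exp (- t\<^sup>2 / 2) * f t)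
        = z ^ n * complex_of_real (g n t)" for n
      by (simp only: g_def scaleR_conv_of_real of_real_mult of_real_power power_mult_distrib
          divide_inverse of_real_inverse of_real_fact mult_ac)
    with sums_mult2 [OF exp_converges, of "of_real (sqrt 2) * z * of_real t" "complex_of_real (exp (- t\<^sup>2 / 2) * f t)"]
    have "(\<lambda>n. z ^ n * complex_of_real (g n t)) sums
        (exp (of_real (sqrt 2) * z * of_real t) * complex_of_real (exp (- t\<^sup>2 / 2) * f t))"
      by (simp only:)
    then show ?thesis
      by (simp only: sums_iff scaleR_conv_of_real of_real_mult mult_ac)
  qed
  have "L holomorphic_on ball 0 r" for r
  proof (rule power_series_holomorphic)
    fix w :: complex
    show "(\<lambda>n. (CLBINT t. complex_of_real (g n t)) * (w - 0) ^ n) sums L w"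
      using sums [of w] by (simp add: ptwise L_def mult.commute [of _ "w ^ _"])
  qed
  then have "L field_differentiable at w" for w
    by (rule holomorphic_on_imp_differentiable_at [where s = "ball 0 (norm w + 1)"]) auto
  then have "L holomorphic_on UNIV"
    by (simp add: holomorphic_on_def)
  then show ?thesis
    unfolding SB_component_factor [abs_def] L_def [symmetric]
    by (intro holomorphic_intros) auto
qed

section \<open>The identity principle on the real axis and injectivity on one component\<close>

lemma zero_islimpt_of_real: "(0 :: complex) islimpt range of_real"
  unfolding islimpt_sequential
proof (intro exI conjI allI)
  show "complex_of_real (inverse (real (Suc n))) \<in> range of_real - {0}" for n
    by (intro DiffI rangeI) (simp del: of_nat_Suc of_real_inverse)
  show "(\<lambda>n. complex_of_real (inverse (real (Suc n)))) \<longlonglongrightarrow> 0"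
    using tendsto_of_real [OF LIMSEQ_inverse_real_of_nat, where 'a = complex] by simp
qed

lemma entire_eq_zero_of_real:
  assumes "F holomorphic_on UNIV" and "\<And>r. F (complex_of_real r) = 0"
  shows "F z = 0"
  by (rule analytic_continuation [OF assms(1), where U = "range of_real" and \<xi> = 0])
     (use assms zero_islimpt_of_real in auto)

lemma SB_component_eq_zero_imp_AE_zero:
  assumes f: "real_L2 f" and zero: "\<And>r. SB_component f (of_real r) = 0"
  shows "AE t in lborel. f t = 0"
proof -
  \<comment> \<open>The first factor equals 1; in this shape
    \<open>real_L2_exp_gaussian_integrable\<close> applies with c = 0.\<close>
  define g where "g t = exp (0 * \<bar>t\<bar>) * exp (- t\<^sup>2 / 2) * f t" for t
  have "integrable lborel g"
    unfolding g_def by (rule real_L2_exp_gaussian_integrable [OF f])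
  then have "AE t in lborel. g t = 0"
  proof (rule fourier_eq_zero_imp_AE_zero)
    fix y
    \<comment> \<open>Chosen so that sqrt 2 z = i y, which turns the Laplace kernel into the Fourier
      kernel.\<close>
    define z where "z = \<i> * of_real (y / sqrt 2)"
    have "SB_component f z = 0"
      using SB_component_holomorphic [OF f] zero by (rule entire_eq_zero_of_real)
    then have "(CLBINT t. f t *\<^sub>R (exp (of_real (sqrt 2) * z * of_real t) * of_real (exp (- t\<^sup>2 / 2)))) = 0"
      by (simp add: SB_component_factor)
    also have "(\<lambda>t. f t *\<^sub>R (exp (of_real (sqrt 2) * z * of_real t) * of_real (exp (- t\<^sup>2 / 2)))) = (\<lambda>t. g t * iexp (y * t))"
      by (auto simp: z_def g_def scaleR_conv_of_real mult_ac fun_eq_iff)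
    finally show "(CLBINT t. g t * iexp (y * t)) = 0" .
  qed
  then show ?thesis by (simp add: g_def)
qed

section \<open>Gaussian integrability of one component over a slice\<close>

lemma SB_component_continuous: "real_L2 f \<Longrightarrow> continuous_on UNIV (SB_component f)"
  by (intro holomorphic_on_imp_continuous_on SB_component_holomorphic)

text \<open>Completing the square, sqrt 2 x t - t^2/2 = x^2 - (t - sqrt 2 x)^2/2. Once squared, the
  factors in front of the integral are exp (- (x^2 - y^2)), from exp (- z^2 / 2), and exp (2 x^2);
  the weight exp (- (x^2 + y^2)) cancels them exactly.\<close>

lemma norm_SB_component_weighted:
  "(cmod (SB_component f (Complex x y)))\<^sup>2 * exp (- (x\<^sup>2 + y\<^sup>2))
   = (pi powr (- 3/4))\<^sup>2 * (cmod (CLBINT t. f t * exp (- (t - sqrt 2 * x)\<^sup>2 / 2) * iexp (sqrt 2 * y * t)))\<^sup>2"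
proof -
  define A where "A = (CLBINT t. complex_of_real (f t * exp (- (t - sqrt 2 * x)\<^sup>2 / 2)) * iexp (sqrt 2 * y * t))"
  have z: "Complex x y = of_real x + \<i> * of_real y"
    by (rule Complex_eq)
  have Re: "Re (- (Complex x y)\<^sup>2 / 2) = - (x\<^sup>2 - y\<^sup>2) / 2"
    by (simp add: power2_eq_square field_simps)
  have ptwise: "f t *\<^sub>R (exp (of_real (sqrt 2) * Complex x y * of_real t) * of_real (exp (- t\<^sup>2 / 2)))
      = of_real (exp (x\<^sup>2)) * (complex_of_real (f t * exp (- (t - sqrt 2 * x)\<^sup>2 / 2)) * iexp (sqrt 2 * y * t))" for t
  proof -
    have "exp (x\<^sup>2) * exp (- (t - sqrt 2 * x)\<^sup>2 / 2) = exp (sqrt 2 * x * t) * exp (- t\<^sup>2 / 2)"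
      by (simp add: mult_exp_exp power2_diff power_mult_distrib field_simps)
    then have exps: "complex_of_real (exp (x\<^sup>2)) * complex_of_real (exp (- (t - sqrt 2 * x)\<^sup>2 / 2))
        = complex_of_real (exp (sqrt 2 * x * t)) * complex_of_real (exp (- t\<^sup>2 / 2))"
      by (metis of_real_mult)
    have kernel: "exp (of_real (sqrt 2) * Complex x y * of_real t)
        = complex_of_real (exp (sqrt 2 * x * t)) * iexp (sqrt 2 * y * t)"
      unfolding z exp_of_real [symmetric] mult_exp_exp by (simp add: algebra_simps)
    have regroup: "F * ((X * C) * T) = E * (F * G * C)" if "E * G = X * T" for F X C T E G :: complex
    proof -
      have "F * ((X * C) * T) = F * C * (X * T)" by (simp only: mult_ac)
      also have "\<dots> = F * C * (E * G)" by (simp only: that)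
      also have "\<dots> = E * (F * G * C)" by (simp only: mult_ac)
      finally show ?thesis .
    qed
    show ?thesis
      unfolding scaleR_conv_of_real of_real_mult [of "f t"] kernel by (rule regroup [OF exps])
  qed
  have "cmod (SB_component f (Complex x y)) = pi powr (- 3/4) * exp (- (x\<^sup>2 - y\<^sup>2) / 2) * (exp (x\<^sup>2) * cmod A)"
    unfolding SB_component_factor ptwise integral_mult_right_zero A_def norm_mult norm_exp_eq_Re Re
    by simp
  then have "(cmod (SB_component f (Complex x y)))\<^sup>2 * exp (- (x\<^sup>2 + y\<^sup>2))
    = (pi powr (- 3/4))\<^sup>2 * (cmod A)\<^sup>2 * ((exp (- (x\<^sup>2 - y\<^sup>2) / 2))\<^sup>2 * (exp (x\<^sup>2))\<^sup>2 * exp (- (x\<^sup>2 + y\<^sup>2)))"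
    by (simp only: power_mult_distrib mult_ac)
  also have "(exp (- (x\<^sup>2 - y\<^sup>2) / 2))\<^sup>2 * (exp (x\<^sup>2))\<^sup>2 * exp (- (x\<^sup>2 + y\<^sup>2)) = 1"
    unfolding exp_double [symmetric] mult_exp_exp by (simp add: field_simps)
  finally show ?thesis
    by (simp add: A_def)
qed

text \<open>For fixed x, Bessel's inequality in y leaves the integral of f(t)^2 exp (- (t - sqrt 2
  x)^2) over t. Tonelli's theorem then lets x be integrated first, where the Gaussian contributes at
  most sqrt pi whatever t is.\<close>

lemma SB_component_fock:
  assumes f: "real_L2 f"
  shows "(\<integral>\<^sup>+p. ennreal ((cmod (SB_component f (Complex (fst p) (snd p))))\<^sup>2 *
            exp (- ((fst p)\<^sup>2 + (snd p)\<^sup>2))) \<partial>lborel) < \<infinity>"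
proof -
  note [measurable] = real_L2_measurable [OF f]
  define g where "g x t = f t * exp (- (t - sqrt 2 * x)\<^sup>2 / 2)" for x t
  have [measurable]: "g x \<in> borel_measurable borel" for x
    unfolding g_def by measurable
  have g_sq: "(g x t)\<^sup>2 = (f t)\<^sup>2 * exp (- (t - sqrt 2 * x)\<^sup>2)" for x t
    by (simp add: g_def power_mult_distrib exp_double [symmetric])
  have g_int: "integrable lborel (g x)" for x
  proof -
    have "exp (- (t - sqrt 2 * x)\<^sup>2 / 2) \<le> 1 * (exp (sqrt 2 * \<bar>x\<bar> * \<bar>t\<bar>) * exp (- t\<^sup>2 / 2))" for t
    proof -
      have "x * t \<le> \<bar>x\<bar> * \<bar>t\<bar>"
        by (metis abs_ge_self abs_mult)
      then have "sqrt 2 * (x * t) \<le> sqrt 2 * (\<bar>x\<bar> * \<bar>t\<bar>)"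
        by (intro mult_left_mono) auto
      moreover have "- (t - sqrt 2 * x)\<^sup>2 / 2 = sqrt 2 * (x * t) - t\<^sup>2 / 2 - x\<^sup>2"
        by (simp add: power2_diff power_mult_distrib field_simps)
      ultimately have "- (t - sqrt 2 * x)\<^sup>2 / 2 \<le> sqrt 2 * \<bar>x\<bar> * \<bar>t\<bar> + (- t\<^sup>2 / 2)"
        using zero_le_power2 [of x] by (simp only: mult.assoc)
      then show ?thesis
        by (simp add: mult_exp_exp)
    qed
    then have "integrable lborel (\<lambda>t. f t *\<^sub>R exp (- (t - sqrt 2 * x)\<^sup>2 / 2))"
      by (intro real_L2_scaleR_integrable [OF f, where K = 1 and c = "sqrt 2 * \<bar>x\<bar>"]) auto
    then show ?thesis
      by (simp add: g_def [abs_def])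
  qed
  have g2_int: "integrable lborel (\<lambda>t. (g x t)\<^sup>2)" for x
  proof (rule Bochner_Integration.integrable_bound)
    show "integrable lborel (\<lambda>t. (f t)\<^sup>2)"
      using f by (simp add: real_L2_def)
    show "AE t in lborel. norm ((g x t)\<^sup>2) \<le> norm ((f t)\<^sup>2)"
      by (simp add: g_sq mult_left_le)
  qed measurable
  define c where "c = (pi powr (- 3/4))\<^sup>2"
  have c: "c \<ge> 0" by (simp add: c_def)
  define F where "F x y = (cmod (CLBINT t. g x t * iexp (y * t)))\<^sup>2" for x y
  have [measurable]: "F x \<in> borel_measurable borel" for x
    unfolding F_def by measurable
  \<comment> \<open>The substitution y to sqrt 2 y would give a factor 1 / sqrt 2; it is bounded by
    1, since only finiteness matters. The same is done in \<open>gauss\<close>.\<close>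
  have inner: "(\<integral>\<^sup>+y. ennreal (F x (sqrt 2 * y)) \<partial>lborel) \<le> ennreal (2 * pi) * (\<integral>\<^sup>+t. ennreal ((g x t)\<^sup>2) \<partial>lborel)" for x
  proof -
    have "(\<integral>\<^sup>+y. ennreal (F x (sqrt 2 * y)) \<partial>lborel) \<le> ennreal (sqrt 2) * (\<integral>\<^sup>+y. ennreal (F x (sqrt 2 * y)) \<partial>lborel)"
      using mult_right_mono [of 1 "ennreal (sqrt 2)" "\<integral>\<^sup>+y. ennreal (F x (sqrt 2 * y)) \<partial>lborel"] by simp
    also have "\<dots> = (\<integral>\<^sup>+y. ennreal (F x y) \<partial>lborel)"
      using nn_integral_real_affine [of "\<lambda>y. ennreal (F x y)" "sqrt 2" 0] by simp
    also have "\<dots> \<le> ennreal (2 * pi * (LBINT t. (g x t)\<^sup>2))"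
      unfolding F_def by (rule fourier_L2_bound [OF g_int g2_int])
    also have "\<dots> = ennreal (2 * pi) * (\<integral>\<^sup>+t. ennreal ((g x t)\<^sup>2) \<partial>lborel)"
      using g2_int [of x] by (subst nn_integral_eq_integral) (auto simp: ennreal_mult)
    finally show ?thesis .
  qed
  have gauss: "(\<integral>\<^sup>+x. ennreal (exp (- (t - sqrt 2 * x)\<^sup>2)) \<partial>lborel) \<le> ennreal (sqrt pi)" for t
  proof -
    let ?I = "\<integral>\<^sup>+x. ennreal (exp (- (t - sqrt 2 * x)\<^sup>2)) \<partial>lborel"
    have "?I \<le> ennreal (sqrt 2) * ?I"
      using mult_right_mono [of 1 "ennreal (sqrt 2)" ?I] by simp
    also have "\<dots> = (\<integral>\<^sup>+u. ennreal (exp (- (t - u)\<^sup>2)) \<partial>lborel)"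
      using nn_integral_real_affine [of "\<lambda>u. ennreal (exp (- (t - u)\<^sup>2))" "sqrt 2" 0] by simp
    also have "\<dots> = ennreal (sqrt pi)"
      using gaussian_integral_unit [of t]
      by (subst nn_integral_eq_integral) (auto simp: has_bochner_integral_iff power2_commute [of t])
    finally show ?thesis .
  qed
  let ?W = "\<lambda>p. ennreal ((cmod (SB_component f (Complex (fst p) (snd p))))\<^sup>2 * exp (- ((fst p)\<^sup>2 + (snd p)\<^sup>2)))"
  have [measurable]: "?W \<in> borel_measurable (lborel \<Otimes>\<^sub>M lborel)"
  proof -
    have "continuous_on UNIV (\<lambda>p. SB_component f (Complex (fst p) (snd p)))"
      unfolding Complex_eq
      by (rule continuous_on_compose2 [OF SB_component_continuous [OF f]]) (auto intro!: continuous_intros)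
    then have "continuous_on UNIV (\<lambda>p::real\<times>real. (cmod (SB_component f (Complex (fst p) (snd p))))\<^sup>2 * exp (- ((fst p)\<^sup>2 + (snd p)\<^sup>2)))"
      by (intro continuous_intros)
    then have "(\<lambda>p::real\<times>real. (cmod (SB_component f (Complex (fst p) (snd p))))\<^sup>2 * exp (- ((fst p)\<^sup>2 + (snd p)\<^sup>2)))
        \<in> borel_measurable (lborel \<Otimes>\<^sub>M lborel)"
      unfolding lborel_prod by (simp add: borel_measurable_continuous_onI)
    then show ?thesis by measurable
  qed
  have "(\<integral>\<^sup>+p. ?W p \<partial>lborel) = (\<integral>\<^sup>+x. \<integral>\<^sup>+y. ?W (x, y) \<partial>lborel \<partial>lborel)"
    unfolding lborel_prod [symmetric] by (rule lborel.nn_integral_fst [symmetric]) measurable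
  also have "\<dots> = (\<integral>\<^sup>+x. \<integral>\<^sup>+y. ennreal c * ennreal (F x (sqrt 2 * y)) \<partial>lborel \<partial>lborel)"
  proof -
    have "?W (x, y) = ennreal c * ennreal (F x (sqrt 2 * y))" for x y
      unfolding fst_conv snd_conv norm_SB_component_weighted F_def g_def c_def
      by (rule ennreal_mult) auto
    then show ?thesis by (simp only:)
  qed
  also have "\<dots> \<le> (\<integral>\<^sup>+x. ennreal c * (ennreal (2 * pi) * (\<integral>\<^sup>+t. ennreal ((g x t)\<^sup>2) \<partial>lborel)) \<partial>lborel)"
    using inner by (intro nn_integral_mono) (auto simp: nn_integral_cmult intro!: mult_left_mono)
  also have "\<dots> = ennreal c * (ennreal (2 * pi) * (\<integral>\<^sup>+x. \<integral>\<^sup>+t. ennreal ((g x t)\<^sup>2) \<partial>lborel \<partial>lborel))"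
    unfolding g_sq by (subst nn_integral_cmult, measurable, subst nn_integral_cmult, measurable)
  also have "(\<integral>\<^sup>+x. \<integral>\<^sup>+t. ennreal ((g x t)\<^sup>2) \<partial>lborel \<partial>lborel) = (\<integral>\<^sup>+t. \<integral>\<^sup>+x. ennreal ((g x t)\<^sup>2) \<partial>lborel \<partial>lborel)"
    unfolding g_sq by (rule lborel_pair.Fubini') measurable
  also have "\<dots> \<le> (\<integral>\<^sup>+t. ennreal ((f t)\<^sup>2) * ennreal (sqrt pi) \<partial>lborel)"
  proof (rule nn_integral_mono)
    fix t
    have "(\<integral>\<^sup>+x. ennreal ((g x t)\<^sup>2) \<partial>lborel) = ennreal ((f t)\<^sup>2) * (\<integral>\<^sup>+x. ennreal (exp (- (t - sqrt 2 * x)\<^sup>2)) \<partial>lborel)"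
      unfolding g_sq by (subst nn_integral_cmult [symmetric]) (auto simp: ennreal_mult)
    also have "\<dots> \<le> ennreal ((f t)\<^sup>2) * ennreal (sqrt pi)"
      using gauss by (rule mult_left_mono) simp
    finally show "(\<integral>\<^sup>+x. ennreal ((g x t)\<^sup>2) \<partial>lborel) \<le> ennreal ((f t)\<^sup>2) * ennreal (sqrt pi)" .
  qed
  also have "\<dots> = ennreal (LBINT t. (f t)\<^sup>2) * ennreal (sqrt pi)"
    using f by (subst nn_integral_multc) (auto simp: real_L2_def nn_integral_eq_integral)
  finally have "(\<integral>\<^sup>+p. ?W p \<partial>lborel) \<le> ennreal c * (ennreal (2 * pi) * (ennreal (LBINT t. (f t)\<^sup>2) * ennreal (sqrt pi)))"
    by (simp add: mult_left_mono)
  also have "\<dots> < \<infinity>"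
    by (simp add: ennreal_mult_less_top)
  finally show ?thesis .
qed

section \<open>Gaussians as test functions\<close>

text \<open>
  Derivatives of \<open>exp (-1/s)\<close>, extended by \<open>0\<close> to \<open>s \<le> 0\<close>, are combinations of these functions.
\<close>

definition bump_deriv :: "nat \<Rightarrow> real \<Rightarrow> real" where
  "bump_deriv k s = (if s > 0 then inverse s ^ k * exp (- inverse s) else 0)"

lemma bump_deriv_Suc: "bump_deriv k s = s * bump_deriv (Suc k) s"
  by (simp add: bump_deriv_def)

lemma bump_deriv_nonneg: "bump_deriv k s \<ge> 0"
  by (simp add: bump_deriv_def)

text \<open>Only s = 0 is delicate: with y = 1/s the limit from the right is that of y^k exp (- y)
  at infinity.\<close>

lemma isCont_bump_deriv: "isCont (bump_deriv k) s"
proof -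
  consider "s > 0" | "s < 0" | "s = 0" by linarith
  then show ?thesis
  proof cases
    case 1
    have "isCont (\<lambda>s. inverse s ^ k * exp (- inverse s)) s"
      using 1 by (intro continuous_intros) auto
    moreover have "\<forall>\<^sub>F t in nhds s. bump_deriv k t = inverse t ^ k * exp (- inverse t)"
      using eventually_nhds_in_open [of "{0<..}" s] 1
      by (auto simp: bump_deriv_def elim!: eventually_mono)
    ultimately show ?thesis by (simp add: isCont_cong)
  next
    case 2
    have "\<forall>\<^sub>F t in nhds s. bump_deriv k t = 0"
      using eventually_nhds_in_open [of "{..<0}" s] 2
      by (auto simp: bump_deriv_def elim!: eventually_mono)
    then show ?thesis by (simp add: isCont_cong)
  next
    case 3
    have "(bump_deriv k \<longlongrightarrow> 0) (at_right 0)"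
    proof -
      have "((\<lambda>y. y ^ k * exp (- y)) \<longlongrightarrow> (0::real)) at_top"
        using tendsto_power_div_exp_0 [of k] by (simp add: exp_minus divide_inverse)
      then have "((\<lambda>s. inverse s ^ k * exp (- inverse s)) \<longlongrightarrow> (0::real)) (at_right 0)"
        by (rule filterlim_compose [OF _ filterlim_inverse_at_top_right])
      then show ?thesis
        by (rule Lim_transform_eventually)
           (auto simp: bump_deriv_def intro: eventually_mono [OF eventually_at_right_less])
    qed
    moreover have "(bump_deriv k \<longlongrightarrow> 0) (at_left 0)"
    proof (rule Lim_transform_eventually [OF tendsto_const])
      show "\<forall>\<^sub>F t in at_left 0. 0 = bump_deriv k t"
        by (auto simp: bump_deriv_def eventually_at_left_field intro!: exI [of _ "-1"])
    qed
    ultimately show ?thesis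
      using 3 by (simp add: isCont_def filterlim_split_at bump_deriv_def)
  qed
qed

lemma bump_deriv_has_derivative:
  "(bump_deriv k has_real_derivative bump_deriv (k + 2) s - k * bump_deriv (Suc k) s) (at s)"
proof -
  consider "s > 0" | "s < 0" | "s = 0" by linarith
  then show ?thesis
  proof cases
    case 1
    have "((\<lambda>s. inverse s ^ k * exp (- inverse s)) has_real_derivative
        (bump_deriv (k + 2) s - k * bump_deriv (Suc k) s)) (at s)"
      \<comment> \<open>The power rule produces the natural exponent k - 1, hence the separate case
        k = 0.\<close>
      using 1 by (cases k) (auto intro!: derivative_eq_intros simp: bump_deriv_def power2_eq_square field_simps,
          metis Suc_pred neq0_conv power_Suc)
    then show ?thesis
      by (rule has_field_derivative_transform_within_open [where S = "{0<..}"])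
        (use 1 in \<open>auto simp: bump_deriv_def\<close>)
  next
    case 2
    then have "((\<lambda>s. 0) has_real_derivative (bump_deriv (k + 2) s - k * bump_deriv (Suc k) s)) (at s)"
      by (simp add: bump_deriv_def)
    then show ?thesis
      by (rule has_field_derivative_transform_within_open [where S = "{..<0}"])
        (use 2 in \<open>auto simp: bump_deriv_def\<close>)
  next
    case 3
    show ?thesis
      \<comment> \<open>Caratheodory's criterion at 0: the difference quotient of
        \<open>bump_deriv k\<close> is \<open>bump_deriv (Suc k)\<close>, which is continuous and
        vanishes at 0.\<close>
      unfolding CARAT_DERIV
      by (rule exI [of _ "bump_deriv (Suc k)"])
        (auto simp: 3 isCont_bump_deriv, auto simp: bump_deriv_def)
  qed
qed

lemma bump_deriv_0_le: "bump_deriv 0 s \<le> 1"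
  by (simp add: bump_deriv_def)

text \<open>With y = 1/s the value is y^2 exp (- y), and 1 + y + y^2/2 \<le> exp y gives the
  constant 2. The bound serves as a domination uniform in the cutoff radius.\<close>

lemma bump_deriv_2_le: "bump_deriv 2 s \<le> 2"
proof (cases "s > 0")
  case True
  define y where "y = inverse s"
  have "y > 0" using True by (simp add: y_def)
  then have "y\<^sup>2 \<le> 2 * exp y"
    using exp_lower_Taylor_quadratic [of y] by simp
  then have "y\<^sup>2 * exp (- y) \<le> 2"
    by (simp add: exp_minus field_simps)
  with True show ?thesis
    by (simp add: bump_deriv_def y_def)
qed (simp add: bump_deriv_def)

text \<open>The part of the transform kernel at the real point r that depends on t; what is missing
  is a constant factor in t.\<close>

definition tilted_gaussian :: "real \<Rightarrow> real \<Rightarrow> real" where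
  "tilted_gaussian r t = exp (- t\<^sup>2 / 2 + sqrt 2 * r * t)"

lemma tilted_gaussian_has_derivative:
  "(tilted_gaussian r has_real_derivative (sqrt 2 * r - t) * tilted_gaussian r t) (at t)"
  unfolding tilted_gaussian_def by (auto intro!: derivative_eq_intros)

lemma tilted_gaussian_measurable [measurable]: "tilted_gaussian r \<in> borel_measurable borel"
  unfolding tilted_gaussian_def by measurable

lemma tilted_gaussian_le: "tilted_gaussian r t \<le> exp (sqrt 2 * \<bar>r\<bar> * \<bar>t\<bar>) * exp (- t\<^sup>2 / 2)"
proof -
  have "r * t \<le> \<bar>r\<bar> * \<bar>t\<bar>"
    by (metis abs_ge_self abs_mult)
  then have "sqrt 2 * (r * t) \<le> sqrt 2 * (\<bar>r\<bar> * \<bar>t\<bar>)"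
    by (intro mult_left_mono) auto
  then show ?thesis
    by (simp add: tilted_gaussian_def mult_exp_exp mult.assoc)
qed

lemma abs_mult_tilted_gaussian_le:
  "\<bar>t\<bar> * tilted_gaussian r t \<le> exp ((sqrt 2 * \<bar>r\<bar> + 1) * \<bar>t\<bar>) * exp (- t\<^sup>2 / 2)"
proof -
  have "\<bar>t\<bar> \<le> exp \<bar>t\<bar>"
    using exp_ge_add_one_self [of "\<bar>t\<bar>"] by linarith
  then have "\<bar>t\<bar> * tilted_gaussian r t \<le> exp \<bar>t\<bar> * (exp (sqrt 2 * \<bar>r\<bar> * \<bar>t\<bar>) * exp (- t\<^sup>2 / 2))"
    using tilted_gaussian_le [of r t] by (intro mult_mono) (auto simp: tilted_gaussian_def)
  then show ?thesis
    by (simp add: mult_exp_exp algebra_simps)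
qed

text \<open>For N > 0 the polynomial 1 - t^2 / N^2 is positive exactly on the open interval from -N
  to N, so composing \<open>bump_deriv\<close> with it gives compact support. A polynomial keeps the
  derivatives inside an explicit family, and it tends to 1 pointwise as N grows.\<close>

definition cutoff :: "real \<Rightarrow> real poly" where
  "cutoff N = [:1, 0, - 1 / N\<^sup>2:]"

text \<open>
  A family closed under differentiation: lower powers of \<open>1/s\<close> are raised to the highest one by
  multiplying the polynomial with the cutoff.
\<close>

definition truncated_gaussian :: "real \<Rightarrow> real \<Rightarrow> nat \<Rightarrow> real poly \<Rightarrow> real \<Rightarrow> real" where
  "truncated_gaussian r N k p t = bump_deriv k (poly (cutoff N) t) * poly p t * tilted_gaussian r t"

text \<open>The product rule yields terms of index k + 2, k + 1 and k. Bringing all of them to index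
  k + 2 multiplies them by the cutoff to the power 0, 1 and 2 respectively.\<close>

definition truncated_gaussian_deriv_poly :: "real \<Rightarrow> real \<Rightarrow> nat \<Rightarrow> real poly \<Rightarrow> real poly" where
  "truncated_gaussian_deriv_poly r N k p =
     pderiv (cutoff N) * p - smult (of_nat k) (cutoff N * pderiv (cutoff N) * p)
     + (cutoff N)\<^sup>2 * (pderiv p + [:sqrt 2 * r, -1:] * p)"

lemma truncated_gaussian_has_derivative:
  "(truncated_gaussian r N k p has_real_derivative
      truncated_gaussian r N (k + 2) (truncated_gaussian_deriv_poly r N k p) t) (at t)"
proof -
  let ?w = "poly (cutoff N) t" and ?w' = "poly (pderiv (cutoff N)) t"
  have k1: "bump_deriv (Suc k) ?w = ?w * bump_deriv (k + 2) ?w"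
    using bump_deriv_Suc [of "Suc k"] by simp
  have k0: "bump_deriv k ?w = ?w * (?w * bump_deriv (k + 2) ?w)"
    unfolding k1 [symmetric] by (rule bump_deriv_Suc)
  have "((\<lambda>t. bump_deriv k (poly (cutoff N) t)) has_real_derivative
      (bump_deriv (k + 2) ?w - k * bump_deriv (Suc k) ?w) * ?w') (at t)"
    by (rule DERIV_chain2 [OF bump_deriv_has_derivative poly_DERIV])
  from DERIV_mult [OF DERIV_mult [OF this poly_DERIV [of p]] tilted_gaussian_has_derivative [of r]]
  show ?thesis
    unfolding truncated_gaussian_def [abs_def] truncated_gaussian_deriv_poly_def k1 k0
    by (rule DERIV_cong) (simp add: algebra_simps power2_eq_square)
qed

text \<open>By induction each iterated derivative is again a \<open>truncated_gaussian\<close> with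
  another index and polynomial, so one differentiation formula covers all orders. Compact support
  holds because \<open>bump_deriv\<close> vanishes at arguments that are not positive.\<close>

lemma test_function_truncated_gaussian:
  assumes "N > 0"
  shows "test_function (truncated_gaussian r N k p)"
  unfolding test_function_def
proof (intro conjI allI)
  fix n
  have "\<exists>k p. (deriv ^^ n) (truncated_gaussian r N k0 p0) = truncated_gaussian r N k p" for k0 p0
  proof (induction n)
    case (Suc n)
    then obtain k p where eq: "(deriv ^^ n) (truncated_gaussian r N k0 p0) = truncated_gaussian r N k p"
      by blast
    have "(deriv ^^ Suc n) (truncated_gaussian r N k0 p0)
        = truncated_gaussian r N (k + 2) (truncated_gaussian_deriv_poly r N k p)"
      unfolding funpow.simps comp_apply eq
      by (rule ext) (rule DERIV_imp_deriv [OF truncated_gaussian_has_derivative])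
    then show ?case by blast
  qed auto
  then obtain k' p' where eq: "(deriv ^^ n) (truncated_gaussian r N k p) = truncated_gaussian r N k' p'"
    by blast
  show "(deriv ^^ n) (truncated_gaussian r N k p) differentiable_on UNIV"
    unfolding eq differentiable_on_def
    by (meson truncated_gaussian_has_derivative real_differentiable_def differentiable_at_withinI)
next
  have "{t. truncated_gaussian r N k p t \<noteq> 0} \<subseteq> cball 0 N"
  proof
    fix t assume "t \<in> {t. truncated_gaussian r N k p t \<noteq> 0}"
    then have "poly (cutoff N) t > 0"
      by (auto simp: truncated_gaussian_def bump_deriv_def split: if_splits)
    then have "t\<^sup>2 < N\<^sup>2"
      using assms by (simp add: cutoff_def field_simps power2_eq_square)
    then show "t \<in> cball 0 N"
      using assms abs_le_square_iff [of t N] by simp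
  qed
  then show "compact (closure {t. truncated_gaussian r N k p t \<noteq> 0})"
    by (meson bounded_cball bounded_subset compact_closure)
qed

section \<open>The weak derivative tested against Gaussians\<close>

lemma square_integrable_measurable [measurable_dest]:
  "square_integrable f \<Longrightarrow> f \<in> borel_measurable borel"
  by (simp add: square_integrable_def)

lemma gaussian_scaleR_integrable:
  assumes f: "square_integrable f" and [measurable]: "h \<in> borel_measurable borel"
    and le: "\<And>t. \<bar>h t\<bar> \<le> K * (exp (c * \<bar>t\<bar>) * exp (- t\<^sup>2 / 2))"
  shows "integrable lborel (\<lambda>t. h t *\<^sub>R f t)"
proof -
  note [measurable] = square_integrable_measurable [OF f]
  have "real_L2 (\<lambda>t. norm (f t))"
    using f by (simp add: real_L2_def square_integrable_def)
  then have "integrable lborel (\<lambda>t. norm (f t) *\<^sub>R h t)"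
    using le by (intro real_L2_scaleR_integrable) auto
  then show ?thesis
    by (rule Bochner_Integration.integrable_bound) (auto simp: abs_mult)
qed

lemma tilted_gaussian_integrable:
  assumes "square_integrable f"
  shows "integrable lborel (\<lambda>t. tilted_gaussian r t *\<^sub>R f t)"
  using tilted_gaussian_le
  by (intro gaussian_scaleR_integrable [OF assms, where K = 1 and c = "sqrt 2 * \<bar>r\<bar>"])
    (auto simp: tilted_gaussian_def)

lemma mult_tilted_gaussian_integrable:
  assumes "square_integrable f"
  shows "integrable lborel (\<lambda>t. (t * tilted_gaussian r t) *\<^sub>R f t)"
  using abs_mult_tilted_gaussian_le
  by (intro gaussian_scaleR_integrable [OF assms, where K = 1 and c = "sqrt 2 * \<bar>r\<bar> + 1"])
    (auto simp: tilted_gaussian_def abs_mult)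

text \<open>The weak identity holds for the truncations \<eta> n, and dominated convergence carries
  both sides to the limit. The term in which the cutoff is differentiated has the factor - 2 t / (n
  + 1)^2 and disappears.\<close>

lemma weak_derivative_tilted_gaussian:
  assumes f: "square_integrable f" and g: "square_integrable g"
    and weak: "\<And>\<eta>. test_function \<eta> \<Longrightarrow>
      (LINT t|lborel. deriv \<eta> t *\<^sub>R f t) = - (LINT t|lborel. \<eta> t *\<^sub>R g t)"
  shows "(LINT t|lborel. ((sqrt 2 * r - t) * tilted_gaussian r t) *\<^sub>R f t)
       = - (LINT t|lborel. tilted_gaussian r t *\<^sub>R g t)"
proof -
  note [measurable] = square_integrable_measurable [OF f] square_integrable_measurable [OF g]
  let ?G = "tilted_gaussian r"
  have G_pos: "?G t > 0" for t by (simp add: tilted_gaussian_def)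
  \<comment> \<open>\<open>Suc n\<close> keeps the radius positive; index 0 and polynomial 1 give
    the Gaussian times the plain cutoff.\<close>
  define \<eta> where "\<eta> n = truncated_gaussian r (real (Suc n)) 0 1" for n
  define w where "w n t = poly (cutoff (real (Suc n))) t" for n t
  have test: "test_function (\<eta> n)" for n
    unfolding \<eta>_def by (rule test_function_truncated_gaussian) simp
  note [measurable] = test_function_measurable [OF test]
  have \<eta>_eq: "\<eta> n t = bump_deriv 0 (w n t) * ?G t" for n t
    by (simp add: \<eta>_def truncated_gaussian_def w_def)
  have w_eq: "w n t = 1 - t\<^sup>2 / (real (Suc n))\<^sup>2" for n t
    by (simp add: w_def cutoff_def power2_eq_square)
  have deriv_eq: "deriv (\<eta> n) t = bump_deriv 2 (w n t) * (- 2 * t / (real (Suc n))\<^sup>2) * ?G t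
      + bump_deriv 0 (w n t) * ((sqrt 2 * r - t) * ?G t)" for n t
  proof (rule DERIV_imp_deriv)
    have "((w n) has_real_derivative (- 2 * t / (real (Suc n))\<^sup>2)) (at t)"
      unfolding w_eq [abs_def] divide_inverse by (auto intro!: derivative_eq_intros)
    from DERIV_mult [OF DERIV_chain2 [OF bump_deriv_has_derivative [of 0] this] tilted_gaussian_has_derivative [of r]]
    show "(\<eta> n has_real_derivative bump_deriv 2 (w n t) * (- 2 * t / (real (Suc n))\<^sup>2) * ?G t
      + bump_deriv 0 (w n t) * ((sqrt 2 * r - t) * ?G t)) (at t)"
      unfolding \<eta>_eq [abs_def] by (rule DERIV_cong) (simp add: numeral_2_eq_2)
  qed
  have w_lim: "(\<lambda>n. w n t) \<longlonglongrightarrow> 1" for t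
    unfolding w_eq by real_asymp
  have bump_lim: "(\<lambda>n. bump_deriv k (w n t)) \<longlonglongrightarrow> bump_deriv k 1" for k t
    by (rule isCont_tendsto_compose [OF isCont_bump_deriv w_lim])
  \<comment> \<open>This is exp (-1), the limit of the cutoff factor, which is not normalised to 1.
    Being nonzero, it is cancelled from both limits at the end.\<close>
  define c where "c = bump_deriv 0 1"
  have c: "c \<noteq> 0" by (simp add: c_def bump_deriv_def)
  have lim_g: "(\<lambda>n. LINT t|lborel. \<eta> n t *\<^sub>R g t) \<longlonglongrightarrow> (LINT t|lborel. (c * ?G t) *\<^sub>R g t)"
  proof (rule integral_dominated_convergence)
    show "integrable lborel (\<lambda>t. norm (?G t *\<^sub>R g t))"
      by (intro integrable_norm tilted_gaussian_integrable g)
    show "AE t in lborel. (\<lambda>n. \<eta> n t *\<^sub>R g t) \<longlonglongrightarrow> (c * ?G t) *\<^sub>R g t"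
      unfolding \<eta>_eq c_def by (intro AE_I2 tendsto_intros bump_lim)
    show "AE t in lborel. norm (\<eta> n t *\<^sub>R g t) \<le> norm (?G t *\<^sub>R g t)" for n
    proof (rule AE_I2)
      fix t
      have "\<bar>\<eta> n t\<bar> \<le> 1 * ?G t"
        unfolding \<eta>_eq abs_mult using bump_deriv_0_le [of "w n t"] bump_deriv_nonneg [of 0 "w n t"] G_pos [of t]
        by (intro mult_mono) auto
      then show "norm (\<eta> n t *\<^sub>R g t) \<le> norm (?G t *\<^sub>R g t)"
        using G_pos [of t] by (simp add: mult_right_mono)
    qed
  qed measurable
  have lim_f: "(\<lambda>n. LINT t|lborel. deriv (\<eta> n) t *\<^sub>R f t) \<longlonglongrightarrow> (LINT t|lborel. (c * ((sqrt 2 * r - t) * ?G t)) *\<^sub>R f t)"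
  proof (rule integral_dominated_convergence)
    \<comment> \<open>The 5 is 4 + 1: the differentiated cutoff contributes 2 (from
      \<open>bump_deriv_2_le\<close>) times 2 |t|, and the factor sqrt 2 r - t contributes another
      |t|.\<close>
    show "integrable lborel (\<lambda>t. 5 * norm ((t * ?G t) *\<^sub>R f t) + sqrt 2 * \<bar>r\<bar> * norm (?G t *\<^sub>R f t))"
      by (intro Bochner_Integration.integrable_add integrable_mult_right integrable_norm
          tilted_gaussian_integrable mult_tilted_gaussian_integrable f)
    show "AE t in lborel. (\<lambda>n. deriv (\<eta> n) t *\<^sub>R f t) \<longlonglongrightarrow> (c * ((sqrt 2 * r - t) * ?G t)) *\<^sub>R f t"
    proof (rule AE_I2)
      fix t
      have "(\<lambda>n. - 2 * t / (real (Suc n))\<^sup>2) \<longlonglongrightarrow> 0"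
        by real_asymp
      then have "(\<lambda>n. deriv (\<eta> n) t) \<longlonglongrightarrow> bump_deriv 2 1 * 0 * ?G t + c * ((sqrt 2 * r - t) * ?G t)"
        unfolding deriv_eq c_def by (intro tendsto_intros bump_lim)
      then show "(\<lambda>n. deriv (\<eta> n) t *\<^sub>R f t) \<longlonglongrightarrow> (c * ((sqrt 2 * r - t) * ?G t)) *\<^sub>R f t"
        by (intro tendsto_intros) simp
    qed
    show "AE t in lborel. norm (deriv (\<eta> n) t *\<^sub>R f t)
        \<le> 5 * norm ((t * ?G t) *\<^sub>R f t) + sqrt 2 * \<bar>r\<bar> * norm (?G t *\<^sub>R f t)" for n
    proof (rule AE_I2)
      fix t
      have "\<bar>- 2 * t / (real (Suc n))\<^sup>2\<bar> \<le> 2 * \<bar>t\<bar>"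
        by (simp add: abs_mult divide_le_eq mult_le_cancel_left1)
      then have 1: "\<bar>bump_deriv 2 (w n t) * (- 2 * t / (real (Suc n))\<^sup>2) * ?G t\<bar> \<le> 2 * (2 * \<bar>t\<bar>) * ?G t"
        unfolding abs_mult using bump_deriv_2_le [of "w n t"] bump_deriv_nonneg [of 2 "w n t"] G_pos [of t]
        by (intro mult_mono) auto
      have "\<bar>sqrt 2 * r - t\<bar> \<le> sqrt 2 * \<bar>r\<bar> + \<bar>t\<bar>"
        using abs_triangle_ineq4 [of "sqrt 2 * r" t] by (simp add: abs_mult)
      then have 2: "\<bar>bump_deriv 0 (w n t) * ((sqrt 2 * r - t) * ?G t)\<bar> \<le> 1 * ((sqrt 2 * \<bar>r\<bar> + \<bar>t\<bar>) * ?G t)"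
        unfolding abs_mult using bump_deriv_0_le [of "w n t"] bump_deriv_nonneg [of 0 "w n t"] G_pos [of t]
        by (intro mult_mono) auto
      have "\<bar>deriv (\<eta> n) t\<bar> \<le> 5 * (\<bar>t\<bar> * ?G t) + sqrt 2 * \<bar>r\<bar> * ?G t"
        unfolding deriv_eq using order_trans [OF abs_triangle_ineq add_mono [OF 1 2]]
        by (simp add: algebra_simps)
      then have "\<bar>deriv (\<eta> n) t\<bar> * norm (f t) \<le> (5 * (\<bar>t\<bar> * ?G t) + sqrt 2 * \<bar>r\<bar> * ?G t) * norm (f t)"
        by (rule mult_right_mono) simp
      then show "norm (deriv (\<eta> n) t *\<^sub>R f t)
        \<le> 5 * norm ((t * ?G t) *\<^sub>R f t) + sqrt 2 * \<bar>r\<bar> * norm (?G t *\<^sub>R f t)"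
        using G_pos [of t] by (simp add: abs_mult algebra_simps)
    qed
  qed measurable
  have "(LINT t|lborel. (c * ((sqrt 2 * r - t) * ?G t)) *\<^sub>R f t) = - (LINT t|lborel. (c * ?G t) *\<^sub>R g t)"
    by (rule LIMSEQ_unique [OF lim_f [unfolded weak [OF test]] tendsto_minus [OF lim_g]])
  then have "c *\<^sub>R (LINT t|lborel. ((sqrt 2 * r - t) * ?G t) *\<^sub>R f t) = c *\<^sub>R - (LINT t|lborel. ?G t *\<^sub>R g t)"
    by (simp flip: scaleR_scaleR)
  with c show ?thesis
    by (simp only: scaleR_cancel_left) simp
qed

section \<open>The quaternionic transform\<close>

lemma imag_sphere_iff:
  "I \<in> imag_sphere \<longleftrightarrow> qRe I = 0 \<and> (qI I)\<^sup>2 + (qJ I)\<^sup>2 + (qK I)\<^sup>2 = 1"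
proof
  assume "I \<in> imag_sphere"
  then have eqs: "qRe I * qRe I - qI I * qI I - qJ I * qJ I - qK I * qK I = -1"
      "qRe I * qI I = 0" "qRe I * qJ I = 0" "qRe I * qK I = 0"
    by (auto simp: imag_sphere_def power2_eq_square quat_eq_iff quat_arith_defs)
  have "qRe I = 0"
  proof (rule ccontr)
    assume "qRe I \<noteq> 0"
    then have "qI I = 0" "qJ I = 0" "qK I = 0" using eqs by auto
    then have "qRe I * qRe I = -1" using eqs(1) by simp
    then show False using zero_le_square [of "qRe I"] by linarith
  qed
  then show "qRe I = 0 \<and> (qI I)\<^sup>2 + (qJ I)\<^sup>2 + (qK I)\<^sup>2 = 1"
    using eqs(1) by (simp add: power2_eq_square)
next
  assume "qRe I = 0 \<and> (qI I)\<^sup>2 + (qJ I)\<^sup>2 + (qK I)\<^sup>2 = 1"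
  then show "I \<in> imag_sphere"
    by (auto simp: imag_sphere_def power2_eq_square quat_eq_iff quat_arith_defs)
qed

lemma of_real_quat: "of_real x = Quat x 0 0 0"
  by (simp add: of_real_def scaleR_quat_def one_quat_def)

lemma norm_slice_pt:
  assumes "I \<in> imag_sphere"
  shows "(norm (slice_pt I x y))\<^sup>2 = x\<^sup>2 + y\<^sup>2"
proof -
  have "(norm (slice_pt I x y))\<^sup>2 = x\<^sup>2 + y\<^sup>2 * ((qI I)\<^sup>2 + (qJ I)\<^sup>2 + (qK I)\<^sup>2)"
    using assms [unfolded imag_sphere_iff, THEN conjunct1]
    unfolding slice_pt_def of_real_quat power2_norm_eq_inner
    by (simp add: inner_quat_def quat_arith_defs power2_eq_square algebra_simps)
  with assms show ?thesis
    by (simp add: imag_sphere_iff)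
qed

lemma quat_slice_cases:
  obtains I x y where "I \<in> imag_sphere" "q = slice_pt I x y"
proof (cases "qI q = 0 \<and> qJ q = 0 \<and> qK q = 0")
  case True
  show ?thesis
  proof (rule that)
    show "Quat 0 1 0 0 \<in> imag_sphere"
      by (simp add: imag_sphere_iff)
    show "q = slice_pt (Quat 0 1 0 0) (qRe q) 0"
      using True by (simp add: slice_pt_def of_real_quat quat_eq_iff quat_arith_defs)
  qed
next
  case False
  define n where "n = sqrt ((qI q)\<^sup>2 + (qJ q)\<^sup>2 + (qK q)\<^sup>2)"
  have "(qI q)\<^sup>2 + (qJ q)\<^sup>2 + (qK q)\<^sup>2 > 0"
    using False by (smt (verit) zero_le_power2 zero_less_power2)
  then have n: "n > 0" "n\<^sup>2 = (qI q)\<^sup>2 + (qJ q)\<^sup>2 + (qK q)\<^sup>2"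
    by (auto simp: n_def)
  show ?thesis
  proof (rule that)
    show "Quat 0 (qI q / n) (qJ q / n) (qK q / n) \<in> imag_sphere"
      using n(1) by (simp add: imag_sphere_iff power_divide add_divide_distrib [symmetric] n(2) [symmetric])
    show "q = slice_pt (Quat 0 (qI q / n) (qJ q / n) (qK q / n)) (qRe q) n"
      using n by (simp add: slice_pt_def of_real_quat quat_eq_iff quat_arith_defs)
  qed
qed

text \<open>For I in \<open>imag_sphere\<close> this is the real algebra homomorphism from the
  complex numbers onto the slice of I that sends \<i> to I; through it complex analysis is
  transported to the slice.\<close>

definition slice_embed :: "quat \<Rightarrow> complex \<Rightarrow> quat" where
  "slice_embed I z = slice_pt I (Re z) (Im z)"

lemma slice_embed_alt: "slice_embed I z = Re z *\<^sub>R 1 + Im z *\<^sub>R I"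
  by (simp add: slice_embed_def slice_pt_def of_real_def)

lemma slice_pt_eq_slice_embed: "slice_pt I x y = slice_embed I (Complex x y)"
  by (simp add: slice_embed_def)

lemma bounded_linear_slice_embed: "bounded_linear (slice_embed I)"
  unfolding slice_embed_alt [abs_def]
  by (intro bounded_linear_add bounded_linear_scaleR_const bounded_linear_Re bounded_linear_Im)

lemmas slice_embed_linear_simps =
  linear_add [OF bounded_linear.linear [OF bounded_linear_slice_embed]]
  linear_neg [OF bounded_linear.linear [OF bounded_linear_slice_embed]]
  linear_scale [OF bounded_linear.linear [OF bounded_linear_slice_embed]]

lemma slice_embed_of_real: "slice_embed I (of_real r) = of_real r"
  by (simp add: slice_embed_alt of_real_def)

lemma slice_embed_mult:
  assumes "I \<in> imag_sphere"
  shows "slice_embed I (w * z) = slice_embed I w * slice_embed I z"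
proof -
  have "I * I = -1"
    using assms by (simp add: imag_sphere_def power2_eq_square)
  then show ?thesis
    by (simp add: slice_embed_alt algebra_simps)
qed

lemma slice_embed_power:
  assumes "I \<in> imag_sphere"
  shows "slice_embed I (z ^ n) = slice_embed I z ^ n"
  using slice_embed_of_real [of I 1]
  by (induction n) (simp_all add: slice_embed_mult [OF assms])

lemma slice_embed_exp:
  assumes "I \<in> imag_sphere"
  shows "slice_embed I (exp z) = exp (slice_embed I z)"
proof -
  have "(\<lambda>n. slice_embed I (z ^ n /\<^sub>R fact n)) sums slice_embed I (exp z)"
    by (rule bounded_linear.sums [OF bounded_linear_slice_embed exp_converges])
  then have "(\<lambda>n. slice_embed I z ^ n /\<^sub>R fact n) sums slice_embed I (exp z)"
    by (simp only: slice_embed_linear_simps slice_embed_power [OF assms])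
  then show ?thesis
    by (rule sums_unique2 [OF _ exp_converges])
qed

lemma norm_slice_embed: "I \<in> imag_sphere \<Longrightarrow> norm (slice_embed I z) = cmod z"
  using norm_slice_pt [of I "Re z" "Im z"]
  by (simp add: slice_embed_def cmod_def real_sqrt_unique)

text \<open>The kernel is assembled from q by real scalars, sums, products and \<open>exp\<close>,
  all of which the embedding preserves.\<close>

lemma SB_kernel_slice_embed:
  assumes I: "I \<in> imag_sphere"
  shows "SB_kernel (slice_embed I z) t = slice_embed I (SB_kernel_complex z t)"
proof -
  have half: "w / 2 = (1/2) *\<^sub>R w" for w :: complex
    by (simp add: scaleR_conv_of_real)
  show ?thesis
    unfolding SB_kernel_def SB_kernel_complex_def half scaleR_conv_of_real [symmetric] slice_embed_linear_simps
      slice_embed_exp [OF I] slice_embed_mult [OF I] slice_embed_power [OF I] slice_embed_of_real ..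
qed

lemma real_L2_inner:
  assumes f: "square_integrable f" and b: "b \<in> Basis"
  shows "real_L2 (\<lambda>t. f t \<bullet> b)"
proof -
  note [measurable] = square_integrable_measurable [OF f]
  have "integrable lborel (\<lambda>t. (f t \<bullet> b)\<^sup>2)"
  proof (rule Bochner_Integration.integrable_bound)
    show "integrable lborel (\<lambda>t. (norm (f t))\<^sup>2)"
      using f by (simp add: square_integrable_def)
    show "AE t in lborel. norm ((f t \<bullet> b)\<^sup>2) \<le> norm ((norm (f t))\<^sup>2)"
    proof (rule AE_I2)
      fix t
      have "(f t \<bullet> b)\<^sup>2 \<le> (norm (f t))\<^sup>2"
        by (rule abs_le_square_iff [THEN iffD1]) (simp add: Basis_le_norm b)
      then show "norm ((f t \<bullet> b)\<^sup>2) \<le> norm ((norm (f t))\<^sup>2)" by simp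
    qed
  qed measurable
  then show ?thesis
    by (simp add: real_L2_def)
qed

section \<open>The transform on a slice and its membership in the Fock space\<close>

lemma L2_rel_refl_iff: "L2_rel f f \<longleftrightarrow> square_integrable f"
  by (auto simp: L2_rel_def)

lemma L2_cases:
  obtains f where "square_integrable f" "\<phi> = abs_L2 f"
  using L2.abs_induct [of "\<lambda>\<phi>. \<exists>f. square_integrable f \<and> \<phi> = abs_L2 f" \<phi>]
  by (auto simp: L2_rel_refl_iff)

lemma abs_L2_eqI:
  "square_integrable f \<Longrightarrow> square_integrable g \<Longrightarrow> AE t in lborel. f t = g t \<Longrightarrow> abs_L2 f = abs_L2 g"
  by (rule Quotient_rel_abs [OF Quotient_L2]) (simp add: L2_rel_def)

lemma SB_abs_L2: "square_integrable f \<Longrightarrow> SB (abs_L2 f) q = (LINT t|lborel. SB_kernel q t * f t)"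
  by (subst SB.abs_eq) (auto simp: L2_rel_refl_iff)

text \<open>The coordinates of f t are real and hence pass through the kernel, while the basis
  elements \<open>b\<close> stay to the right of it. Each coordinate therefore meets only values in
  the slice, where the complex transform applies.\<close>

lemma SB_slice_embed:
  assumes f: "square_integrable f" and I: "I \<in> imag_sphere"
  shows "SB (abs_L2 f) (slice_embed I z)
      = (\<Sum>b\<in>Basis. slice_embed I (SB_component (\<lambda>t. f t \<bullet> b) z) * b)"
proof -
  have bl: "bounded_linear (\<lambda>w. slice_embed I w * b)" for b
    by (rule bounded_linear_mult_left [THEN bounded_linear_compose, OF bounded_linear_slice_embed])
  have int: "integrable lborel (\<lambda>t. (f t \<bullet> b) *\<^sub>R SB_kernel_complex z t)" if "b \<in> Basis" for b
    by (rule SB_component_integrable [OF real_L2_inner [OF f that]])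
  have "SB_kernel (slice_embed I z) t * f t
      = (\<Sum>b\<in>Basis. slice_embed I ((f t \<bullet> b) *\<^sub>R SB_kernel_complex z t) * b)" for t
  proof -
    have "SB_kernel (slice_embed I z) t * f t
        = slice_embed I (SB_kernel_complex z t) * (\<Sum>b\<in>Basis. (f t \<bullet> b) *\<^sub>R b)"
      by (simp add: SB_kernel_slice_embed [OF I] euclidean_representation)
    then show ?thesis
      by (simp add: sum_distrib_left slice_embed_linear_simps)
  qed
  then have "SB (abs_L2 f) (slice_embed I z)
      = (LINT t|lborel. (\<Sum>b\<in>Basis. slice_embed I ((f t \<bullet> b) *\<^sub>R SB_kernel_complex z t) * b))"
    by (simp add: SB_abs_L2 [OF f])
  also have "\<dots> = (\<Sum>b\<in>Basis. LINT t|lborel. slice_embed I ((f t \<bullet> b) *\<^sub>R SB_kernel_complex z t) * b)"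
    by (intro Bochner_Integration.integral_sum integrable_bounded_linear [OF bl] int)
  also have "\<dots> = (\<Sum>b\<in>Basis. slice_embed I (SB_component (\<lambda>t. f t \<bullet> b) z) * b)"
    unfolding SB_component_def
    by (intro sum.cong refl integral_bounded_linear [OF bl] int)
  finally show ?thesis .
qed

text \<open>Right factors \<open>b\<close> do not interfere with left multiplication by I, so the
  Cauchy-Riemann equations pass through the sum: the y-derivative of \<open>F b\<close> is \<i>
  times its x-derivative, the embedding turns \<i> into I, and I I = -1 makes fx + I fy
  vanish.\<close>

lemma slice_regular_entire_components:
  assumes f: "\<And>I z. I \<in> imag_sphere \<Longrightarrow> f (slice_embed I z) = (\<Sum>b\<in>Basis. slice_embed I (F b z) * b)"
    and F: "\<And>b. b \<in> Basis \<Longrightarrow> F b holomorphic_on UNIV"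
  shows "slice_regular f"
  unfolding slice_regular_def
proof
  fix I assume I: "I \<in> imag_sphere"
  then have II: "I * I = -1"
    by (simp add: imag_sphere_def power2_eq_square)
  have emb_i: "slice_embed I \<i> = I"
    by (simp add: slice_embed_alt)
  note bl = bounded_linear_mult_left [THEN bounded_linear_compose, OF bounded_linear_slice_embed]
  define fx where "fx x y = (\<Sum>b\<in>Basis. slice_embed I (deriv (F b) (Complex x y)) * b)" for x y
  define fy where "fy x y = (\<Sum>b\<in>Basis. slice_embed I (\<i> * deriv (F b) (Complex x y)) * b)" for x y
  have cont_deriv: "continuous_on UNIV (\<lambda>(x, y). deriv (F b) (Complex x y))" if "b \<in> Basis" for b
    unfolding Complex_eq case_prod_unfold
    by (rule continuous_on_compose2 [OF holomorphic_on_imp_continuous_on [OF holomorphic_deriv [OF F [OF that]]]])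
      (auto intro!: continuous_intros)
  have cont_emb: "continuous_on UNIV (\<lambda>p. slice_embed I (g p))" if "continuous_on UNIV g" for g :: "real \<times> real \<Rightarrow> complex"
    by (rule bounded_linear.continuous_on [OF bounded_linear_slice_embed that])
  have "continuous_on UNIV (\<lambda>(x, y). fx x y)"
    using cont_deriv unfolding fx_def case_prod_unfold
    by (intro continuous_on_sum continuous_on_mult cont_emb continuous_on_const) auto
  moreover have "continuous_on UNIV (\<lambda>(x, y). fy x y)"
    using cont_deriv unfolding fy_def case_prod_unfold
    by (intro continuous_on_sum continuous_on_mult cont_emb continuous_on_const) auto
  moreover have "((\<lambda>t. f (slice_pt I t y)) has_vector_derivative fx x y) (at x) \<and>
      ((\<lambda>t. f (slice_pt I x t)) has_vector_derivative fy x y) (at y) \<and>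
      (1/2) *\<^sub>R (fx x y + I * fy x y) = 0" for x y
  proof (intro conjI)
    have F': "(F b has_field_derivative deriv (F b) z) (at z)" if "b \<in> Basis" for b z
      using holomorphic_derivI [OF F [OF that]] by simp
    have "((\<lambda>t. Complex t y) has_vector_derivative 1) (at x)"
      unfolding Complex_eq by (auto intro!: derivative_eq_intros simp: of_real_def)
    from field_vector_diff_chain_at [OF this F']
    have "((\<lambda>t. F b (Complex t y)) has_vector_derivative deriv (F b) (Complex x y)) (at x)" if "b \<in> Basis" for b
      using that by (auto simp: o_def)
    then show "((\<lambda>t. f (slice_pt I t y)) has_vector_derivative fx x y) (at x)"
      unfolding fx_def slice_pt_eq_slice_embed f [OF I]
      by (intro has_vector_derivative_sum bounded_linear.has_vector_derivative [OF bl])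
    have "((\<lambda>t. Complex x t) has_vector_derivative \<i>) (at y)"
      unfolding Complex_eq by (auto intro!: derivative_eq_intros simp: of_real_def)
    from field_vector_diff_chain_at [OF this F']
    have "((\<lambda>t. F b (Complex x t)) has_vector_derivative \<i> * deriv (F b) (Complex x y)) (at y)" if "b \<in> Basis" for b
      using that by (auto simp: o_def)
    then show "((\<lambda>t. f (slice_pt I x t)) has_vector_derivative fy x y) (at y)"
      unfolding fy_def slice_pt_eq_slice_embed f [OF I]
      by (intro has_vector_derivative_sum bounded_linear.has_vector_derivative [OF bl])
    have "I * fy x y = (I * I) * fx x y"
      by (simp add: fx_def fy_def sum_distrib_left slice_embed_mult [OF I] emb_i mult.assoc)
    then show "(1/2) *\<^sub>R (fx x y + I * fy x y) = 0"
      by (simp add: II)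
  qed
  ultimately show "\<exists>fx fy. continuous_on UNIV (\<lambda>(x, y). fx x y) \<and> continuous_on UNIV (\<lambda>(x, y). fy x y) \<and>
     (\<forall>x y. ((\<lambda>t. f (slice_pt I t y)) has_vector_derivative fx x y) (at x) \<and>
            ((\<lambda>t. f (slice_pt I x t)) has_vector_derivative fy x y) (at y) \<and>
            (1/2) *\<^sub>R (fx x y + I * fy x y) = 0)"
    by blast
qed

text \<open>Embedding preserves the modulus and basis elements have norm 1, so Cauchy-Schwarz bounds
  the squared norm by \<open>DIM(quat)\<close> times the sum of the squared moduli of the
  components. Each of these is integrable by \<open>SB_component_fock\<close>.\<close>

lemma SB_in_fock_slice: "SB \<phi> \<in> fock_slice"
proof -
  obtain f where f: "square_integrable f" and \<phi>: "\<phi> = abs_L2 f"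
    by (rule L2_cases)
  define F where "F b = SB_component (\<lambda>t. f t \<bullet> b)" for b
  have rep: "SB \<phi> (slice_embed I z) = (\<Sum>b\<in>Basis. slice_embed I (F b z) * b)" if "I \<in> imag_sphere" for I z
    unfolding \<phi> F_def by (rule SB_slice_embed [OF f that])
  have reg: "slice_regular (SB \<phi>)"
    using rep by (rule slice_regular_entire_components)
      (auto simp: F_def intro: SB_component_holomorphic real_L2_inner [OF f])
  have "integrable lborel (\<lambda>(x, y). (norm (SB \<phi> (slice_pt I x y)))\<^sup>2 * exp (- (norm (slice_pt I x y))\<^sup>2))"
    if I: "I \<in> imag_sphere" for I
  proof -
    define W where "W b p = (cmod (F b (Complex (fst p) (snd p))))\<^sup>2 * exp (- ((fst p)\<^sup>2 + (snd p)\<^sup>2))"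
      for b and p :: "real \<times> real"
    have cont_F: "continuous_on UNIV (\<lambda>p. F b (Complex (fst p) (snd p)))" if "b \<in> Basis" for b
      unfolding Complex_eq F_def
      by (rule continuous_on_compose2 [OF SB_component_continuous [OF real_L2_inner [OF f that]]])
        (auto intro!: continuous_intros)
    have W_meas: "W b \<in> borel_measurable borel" if "b \<in> Basis" for b
      unfolding W_def [abs_def]
      by (intro borel_measurable_continuous_onI continuous_intros cont_F that)
    have W_int: "integrable lborel (W b)" if "b \<in> Basis" for b
      using SB_component_fock [OF real_L2_inner [OF f that]] W_meas [OF that]
      by (intro integrableI_nonneg) (auto simp: W_def F_def)
    have bound: "(norm (SB \<phi> (slice_pt I x y)))\<^sup>2 * exp (- (norm (slice_pt I x y))\<^sup>2)
        \<le> (\<Sum>b\<in>Basis. real DIM(quat) * W b (x, y))" for x y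
    proof -
      have "norm (SB \<phi> (slice_pt I x y)) \<le> (\<Sum>b\<in>Basis. norm (slice_embed I (F b (Complex x y)) * b))"
        unfolding slice_pt_eq_slice_embed rep [OF I] by (rule norm_sum)
      also have "\<dots> = (\<Sum>b\<in>(Basis :: quat set). cmod (F b (Complex x y)) * 1)"
        by (simp add: norm_mult norm_slice_embed [OF I])
      finally have "(norm (SB \<phi> (slice_pt I x y)))\<^sup>2 \<le> (\<Sum>b\<in>(Basis :: quat set). cmod (F b (Complex x y)) * 1)\<^sup>2"
        by (rule power_mono) simp
      also have "\<dots> \<le> (\<Sum>b\<in>(Basis :: quat set). (cmod (F b (Complex x y)))\<^sup>2) * (\<Sum>b\<in>(Basis :: quat set). 1\<^sup>2)"
        by (rule Cauchy_Schwarz_ineq_sum)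
      finally have "(norm (SB \<phi> (slice_pt I x y)))\<^sup>2 * exp (- (x\<^sup>2 + y\<^sup>2))
          \<le> ((\<Sum>b\<in>(Basis :: quat set). (cmod (F b (Complex x y)))\<^sup>2) * (\<Sum>b\<in>(Basis :: quat set). 1\<^sup>2)) * exp (- (x\<^sup>2 + y\<^sup>2))"
        by (rule mult_right_mono) simp
      then show ?thesis
        unfolding norm_slice_pt [OF I]
        by (simp add: W_def sum_distrib_left sum_distrib_right mult_ac)
    qed
    have cont: "continuous_on UNIV (\<lambda>p. SB \<phi> (slice_pt I (fst p) (snd p)))"
      unfolding slice_pt_eq_slice_embed rep [OF I]
      by (intro continuous_on_sum continuous_on_mult continuous_on_const
          bounded_linear.continuous_on [OF bounded_linear_slice_embed] cont_F)
    have "continuous_on UNIV (\<lambda>p. (norm (SB \<phi> (slice_pt I (fst p) (snd p))))\<^sup>2 * exp (- ((fst p)\<^sup>2 + (snd p)\<^sup>2)))"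
      by (intro continuous_intros cont)
    then have meas: "(\<lambda>(x, y). (norm (SB \<phi> (slice_pt I x y)))\<^sup>2 * exp (- (norm (slice_pt I x y))\<^sup>2)) \<in> borel_measurable lborel"
      unfolding case_prod_unfold norm_slice_pt [OF I]
      by (simp add: borel_measurable_continuous_onI)
    have "integrable lborel (\<lambda>p. \<Sum>b\<in>(Basis :: quat set). real DIM(quat) * W b p)"
      by (intro Bochner_Integration.integrable_sum integrable_mult_right W_int)
    then show ?thesis
      by (rule Bochner_Integration.integrable_bound [OF _ meas])
        (use bound in \<open>auto intro!: AE_I2 order_trans [OF _ abs_ge_self] simp: abs_mult\<close>)
  qed
  with reg show ?thesis
    by (simp add: fock_slice_def)
qed

section \<open>Real points determine the transform\<close>

lemma SB_kernel_complex_of_real: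
  "SB_kernel_complex (of_real r) t = of_real (pi powr (- 3/4) * exp (- r\<^sup>2 / 2) * tilted_gaussian r t)"
proof -
  have "exp (- (((of_real r)\<^sup>2 + (of_real t)\<^sup>2) / 2) + of_real (sqrt 2) * of_real r * of_real t)
      = complex_of_real (exp (- ((r\<^sup>2 + t\<^sup>2) / 2) + sqrt 2 * r * t))"
    by (simp flip: exp_of_real)
  also have "- ((r\<^sup>2 + t\<^sup>2) / 2) + sqrt 2 * r * t = - r\<^sup>2 / 2 + (- t\<^sup>2 / 2 + sqrt 2 * r * t)"
    by (simp add: field_simps)
  finally have eq: "exp (- (((of_real r)\<^sup>2 + (of_real t)\<^sup>2) / 2) + of_real (sqrt 2) * of_real r * of_real t)
      = complex_of_real (exp (- r\<^sup>2 / 2 + (- t\<^sup>2 / 2 + sqrt 2 * r * t)))" .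
  show ?thesis
    unfolding SB_kernel_complex_def tilted_gaussian_def eq
    unfolding exp_add [of "- r\<^sup>2 / 2"] of_real_mult mult.assoc ..
qed

lemma SB_of_real:
  assumes f: "square_integrable f"
  shows "SB (abs_L2 f) (of_real r)
      = (pi powr (- 3/4) * exp (- r\<^sup>2 / 2)) *\<^sub>R (LINT t|lborel. tilted_gaussian r t *\<^sub>R f t)"
proof -
  \<comment> \<open>A real point lies on every slice, so any imaginary unit serves.\<close>
  have "Quat 0 1 0 0 \<in> imag_sphere"
    by (simp add: imag_sphere_iff)
  from SB_kernel_slice_embed [OF this, of "of_real r"]
  have "SB_kernel (of_real r) t = of_real (pi powr (- 3/4) * exp (- r\<^sup>2 / 2) * tilted_gaussian r t)" for t
    by (simp only: slice_embed_of_real SB_kernel_complex_of_real)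
  then show ?thesis
    unfolding SB_abs_L2 [OF f] integral_scaleR_right [symmetric]
    by (simp add: scaleR_conv_of_real mult.assoc flip: integral_scaleR_right)
qed

text \<open>At a real point the kernel is real, so taking coordinates commutes with the transform.
  This converts quaternionic identities at real points into identities for the entire functions
  \<open>SB_component\<close>.\<close>

lemma SB_component_of_real:
  assumes f: "square_integrable f" and b: "b \<in> Basis"
  shows "SB_component (\<lambda>t. f t \<bullet> b) (of_real r) = of_real (SB (abs_L2 f) (of_real r) \<bullet> b)"
proof -
  let ?k = "pi powr (- 3/4) * exp (- r\<^sup>2 / 2)"
  have "SB_component (\<lambda>t. f t \<bullet> b) (of_real r) = (CLBINT t. of_real (?k * (tilted_gaussian r t *\<^sub>R f t \<bullet> b)))"
    unfolding SB_component_def SB_kernel_complex_of_real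
    by (intro Bochner_Integration.integral_cong refl) (simp add: scaleR_conv_of_real [where 'a = complex])
  also have "\<dots> = of_real (?k * (LINT t|lborel. tilted_gaussian r t *\<^sub>R f t \<bullet> b))"
    by (simp only: integral_complex_of_real integral_mult_right_zero)
  also have "(LINT t|lborel. tilted_gaussian r t *\<^sub>R f t \<bullet> b) = (LINT t|lborel. tilted_gaussian r t *\<^sub>R f t) \<bullet> b"
    by (rule integral_inner_left) (rule tilted_gaussian_integrable [OF f])
  finally show ?thesis
    by (simp add: SB_of_real [OF f])
qed

text \<open>Each coordinate of the difference of representatives has an entire transform that
  vanishes on the real axis, hence is zero almost everywhere. Besides injectivity of
  \<open>SB\<close> this yields uniqueness of the images under the position and momentum
  graphs.\<close>

lemma SB_eq_on_reals_imp_eq: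
  assumes "\<And>r. SB \<phi> (of_real r) = SB \<psi> (of_real r)"
  shows "\<phi> = \<psi>"
proof -
  obtain f g where f: "square_integrable f" "\<phi> = abs_L2 f" and g: "square_integrable g" "\<psi> = abs_L2 g"
    by (metis L2_cases)
  have h: "square_integrable (\<lambda>t. f t - g t)"
    by (rule square_integrable_diff [OF f(1) g(1)])
  have zero: "SB (abs_L2 (\<lambda>t. f t - g t)) (of_real r) = 0" for r
  proof -
    have "(LINT t|lborel. tilted_gaussian r t *\<^sub>R f t) = (LINT t|lborel. tilted_gaussian r t *\<^sub>R g t)"
      using assms [of r] by (simp add: f g SB_of_real)
    then show ?thesis
      unfolding SB_of_real [OF h] scaleR_diff_right
      by (simp add: Bochner_Integration.integral_diff tilted_gaussian_integrable f g)
  qed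
  have "AE t in lborel. (f t - g t) \<bullet> b = 0" if b: "b \<in> Basis" for b
    by (rule SB_component_eq_zero_imp_AE_zero [OF real_L2_inner [OF h b]])
      (simp add: SB_component_of_real [OF h b] zero)
  then have "AE t in lborel. \<forall>b\<in>Basis. (f t - g t) \<bullet> b = 0"
    by (intro AE_finite_allI) auto
  then have "AE t in lborel. f t = g t"
    by eventually_elim (metis eq_iff_diff_eq_0 euclidean_all_zero_iff)
  then show ?thesis
    unfolding f g by (rule abs_L2_eqI [OF f(1) g(1)])
qed

text \<open>In each coordinate, the transform for \<psi> minus z times the one for \<phi> is entire
  and zero on the real axis. On a slice, left multiplication by q corresponds to multiplication by z
  under the embedding, so the identity reaches every q.\<close>

lemma SB_creation_from_reals:
  assumes "\<And>r. SB \<psi> (of_real r) = r *\<^sub>R SB \<phi> (of_real r)"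
  shows "SB \<psi> = creation (SB \<phi>)"
proof
  fix q
  obtain f g where f: "square_integrable f" "\<phi> = abs_L2 f" and g: "square_integrable g" "\<psi> = abs_L2 g"
    by (metis L2_cases)
  obtain I x y where I: "I \<in> imag_sphere" and "q = slice_pt I x y"
    by (rule quat_slice_cases)
  then obtain z where q: "q = slice_embed I z"
    by (auto simp: slice_pt_eq_slice_embed)
  have comp: "SB_component (\<lambda>t. g t \<bullet> b) z = z * SB_component (\<lambda>t. f t \<bullet> b) z" if b: "b \<in> Basis" for b
  proof -
    let ?D = "\<lambda>z. SB_component (\<lambda>t. g t \<bullet> b) z - z * SB_component (\<lambda>t. f t \<bullet> b) z"
    have "?D holomorphic_on UNIV"
      by (intro holomorphic_intros SB_component_holomorphic real_L2_inner f g b)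
    moreover have "?D (of_real r) = 0" for r
      using assms [of r] by (simp add: SB_component_of_real f g b)
    ultimately have "?D z = 0"
      by (rule entire_eq_zero_of_real)
    then show ?thesis by simp
  qed
  show "SB \<psi> q = creation (SB \<phi>) q"
    unfolding q f(2) g(2) creation_def SB_slice_embed [OF f(1) I] SB_slice_embed [OF g(1) I]
    by (simp add: comp slice_embed_mult [OF I] sum_distrib_left mult.assoc)
qed

section \<open>Linearity, position and momentum at real points\<close>

lemma SB_minus: "SB (\<phi> - \<psi>) (of_real r) = SB \<phi> (of_real r) - SB \<psi> (of_real r)"
proof -
  obtain f g where f: "square_integrable f" "\<phi> = abs_L2 f" and g: "square_integrable g" "\<psi> = abs_L2 g"
    by (metis L2_cases)
  have "\<phi> - \<psi> = abs_L2 (\<lambda>t. f t - g t)"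
    unfolding f g by (rule minus_L2.abs_eq) (auto simp: L2_rel_refl_iff f g)
  then show ?thesis
    by (simp add: SB_of_real square_integrable_diff f g scaleR_diff_right
        Bochner_Integration.integral_diff tilted_gaussian_integrable)
qed

lemma SB_scaleR: "SB (c *\<^sub>R \<phi>) (of_real r) = c *\<^sub>R SB \<phi> (of_real r)"
proof -
  obtain f where f: "square_integrable f" "\<phi> = abs_L2 f"
    by (rule L2_cases)
  have "c *\<^sub>R \<phi> = abs_L2 (\<lambda>t. c *\<^sub>R f t)"
    unfolding f by (rule scaleR_L2.abs_eq) (auto simp: L2_rel_refl_iff f)
  then show ?thesis
    by (simp add: SB_of_real square_integrable_scaleR f scaleR_left_commute [of _ c] del: scaleR_scaleR)
qed

text \<open>The right-hand side involves only the representative f of \<phi>. The formula thus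
  serves twice: to compute the transform of the image, and to show that the image is unique.\<close>

lemma position_graph_SB:
  assumes "position_graph \<phi> \<psi>" "square_integrable f" "\<phi> = abs_L2 f"
  shows "SB \<psi> (of_real r) = (pi powr (- 3/4) * exp (- r\<^sup>2 / 2)) *\<^sub>R
    (LINT t|lborel. (t * tilted_gaussian r t) *\<^sub>R f t)"
proof -
  obtain g where g: "square_integrable g" "\<psi> = abs_L2 g"
    by (rule L2_cases)
  note [measurable] = square_integrable_measurable [OF assms(2)] square_integrable_measurable [OF g(1)]
  have "AE t in lborel. g t = t *\<^sub>R f t"
    using assms g by (simp add: position_graph.abs_eq L2_rel_refl_iff)
  then have "(LINT t|lborel. tilted_gaussian r t *\<^sub>R g t) = (LINT t|lborel. (t * tilted_gaussian r t) *\<^sub>R f t)"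
    by (intro integral_cong_AE) (auto elim!: eventually_mono simp: mult.commute)
  then show ?thesis
    by (simp add: g SB_of_real)
qed

text \<open>The kernel at r is a constant times a tilted Gaussian, so the derivative moves onto the
  kernel. As for position, the image \<psi> no longer occurs on the right.\<close>

lemma momentum_graph_SB:
  assumes "momentum_graph \<phi> \<psi>" "square_integrable f" "\<phi> = abs_L2 f"
  shows "SB \<psi> (of_real r) = - ((pi powr (- 3/4) * exp (- r\<^sup>2 / 2)) *\<^sub>R
    (LINT t|lborel. ((sqrt 2 * r - t) * tilted_gaussian r t) *\<^sub>R f t))"
proof -
  obtain g where g: "square_integrable g" "\<psi> = abs_L2 g"
    by (rule L2_cases)
  have "\<forall>\<eta>. test_function \<eta> \<longrightarrow>
      (LINT t|lborel. deriv \<eta> t *\<^sub>R f t) = - (LINT t|lborel. \<eta> t *\<^sub>R g t)"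
    using assms g by (simp add: momentum_graph.abs_eq L2_rel_refl_iff)
  then show ?thesis
    using weak_derivative_tilted_gaussian [OF assms(2) g(1), of r] by (simp add: g SB_of_real)
qed

lemma position_graph_unique: "position_graph \<phi> \<psi> \<Longrightarrow> position_graph \<phi> \<psi>' \<Longrightarrow> \<psi> = \<psi>'"
  by (metis L2_cases position_graph_SB SB_eq_on_reals_imp_eq)

lemma momentum_graph_unique: "momentum_graph \<phi> \<psi> \<Longrightarrow> momentum_graph \<phi> \<psi>' \<Longrightarrow> \<psi> = \<psi>'"
  by (metis L2_cases momentum_graph_SB SB_eq_on_reals_imp_eq)

lemma position_graph_position: "\<phi> \<in> position_dom \<Longrightarrow> position_graph \<phi> (position \<phi>)"
  unfolding position_dom_def position_def by (auto intro: theI2 position_graph_unique)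

lemma momentum_graph_momentum: "\<phi> \<in> momentum_dom \<Longrightarrow> momentum_graph \<phi> (momentum \<phi>)"
  unfolding momentum_dom_def momentum_def by (auto intro: theI2 momentum_graph_unique)

theorem theorem3p8:
  fixes \<phi> :: L2
  assumes "\<phi> \<in> position_dom \<inter> momentum_dom"
  shows "SB \<phi> \<in> creation_dom \<and>
         inv SB (creation (SB \<phi>)) = (1 / sqrt 2) *\<^sub>R (position \<phi> - momentum \<phi>)"
proof -
  define \<psi> where "\<psi> = (1 / sqrt 2) *\<^sub>R (position \<phi> - momentum \<phi>)"
  obtain f where f: "square_integrable f" "\<phi> = abs_L2 f"
    by (rule L2_cases)
  have "SB \<psi> (of_real r) = r *\<^sub>R SB \<phi> (of_real r)" for r
  proof -
    let ?k = "pi powr (- 3/4) * exp (- r\<^sup>2 / 2)" and ?G = "tilted_gaussian r"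
    have split: "((sqrt 2 * r - t) * ?G t) *\<^sub>R f t = (sqrt 2 * r) *\<^sub>R (?G t *\<^sub>R f t) - (t * ?G t) *\<^sub>R f t" for t
      by (simp add: left_diff_distrib scaleR_diff_left)
    have int: "(LINT t|lborel. ((sqrt 2 * r - t) * ?G t) *\<^sub>R f t)
        = (sqrt 2 * r) *\<^sub>R (LINT t|lborel. ?G t *\<^sub>R f t) - (LINT t|lborel. (t * ?G t) *\<^sub>R f t)"
      unfolding split
      by (subst Bochner_Integration.integral_diff)
        (auto intro!: integrable_scaleR_right tilted_gaussian_integrable mult_tilted_gaussian_integrable f(1)
          simp del: scaleR_scaleR)
    have "SB \<psi> (of_real r) = (1 / sqrt 2) *\<^sub>R (?k *\<^sub>R (sqrt 2 * r) *\<^sub>R (LINT t|lborel. ?G t *\<^sub>R f t))"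
      using assms
      by (simp add: \<psi>_def SB_scaleR SB_minus position_graph_SB [OF position_graph_position f]
          momentum_graph_SB [OF momentum_graph_momentum f] int scaleR_diff_right del: scaleR_scaleR)
    then show ?thesis
      by (simp add: f SB_of_real)
  qed
  then have eq: "SB \<psi> = creation (SB \<phi>)"
    by (rule SB_creation_from_reals)
  have "inj SB"
    by (rule injI) (auto intro: SB_eq_on_reals_imp_eq)
  \<comment> \<open>\<open>inv\<close> picks some preimage; the argument equals
    \<open>SB \<psi>\<close>, and injectivity forces the choice \<psi>.\<close>
  then have "inv SB (creation (SB \<phi>)) = \<psi>"
    by (metis eq inv_f_f)
  \<comment> \<open>The product is itself a transform, so the growth of the factor q calls for no
    separate estimate.\<close>
  moreover have "creation (SB \<phi>) \<in> fock_slice"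
    unfolding eq [symmetric] by (rule SB_in_fock_slice)
  ultimately show ?thesis
    using SB_in_fock_slice [of \<phi>] by (simp add: creation_dom_def \<psi>_def)
qed

end
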